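(* Let $M$ be a simply connected domain in $\mathbb{C}$ with coordinate $z$ and metric conformal to $dz\,d\bar z$. Let $\varphi:M\to\mathbb{H}P^n$ be a linearly full totally real isometric harmonic map of isotropy order $n$. Then its totally real horizontal minimal lift $[s]:M\to\mathbb{C}P^{2n+1}$ has isotropy order $n$ or $2n+1$.
   Context: Identify $\mathbb{C}^{2n+2}$ with $\mathbb{H}^{n+1}$ by $(z_1,z_2,\dots,z_{2n+1},z_{2n+2})\leftrightarrow(z_1+z_2\mathrm{j},\dots,z_{2n+1}+z_{2n+2}\mathrm{j})$, with the standard Hermitian product $\langle z,w\rangle=\sum_k z_k\bar w_k$ and real inner product $\mathrm{Re}\langle\cdot,\cdot\rangle$. Left multiplication by $\mathrm{j}$ is the conjugate-linear map $\mathrm{j}v=J_{n+1}\bar v$, where $J_{n+1}$ is block diagonal with $n+1$ blocks $\begin{pmatrix}0&-1\\1&0\end{pmatrix}$. $\mathbb{H}P^n$ is the space of one-dimensional quaternionic subspaces of $\mathbb{H}^{n+1}$ for left scalar multiplication. Write $\pi:S^{4n+3}\to\mathbb{H}P^n$, $\pi(q)=[z_1+z_2\mathrm{j},\dots,z_{2n+1}+z_{2n+2}\mathrm{j}]$; its horizontal space at $q$ is $\mathcal H_q=\{v:\langle v,q\rangle=\langle v,\mathrm{j}q\rangle=0\}$, and $\mathbb{H}P^n$ has the metric making $\pi$ a Riemannian submersion from the unit sphere. The local quaternionic Kähler structure $\{I,J,K\}$ is induced on $\mathcal H_q\cong T_{\pi(q)}\mathbb{H}P^n$ by left multiplication by $\mathrm{i},\mathrm{j},\mathrm{k}$.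 $\mathbb{C}P^{2n+1}$ carries the Fubini–Study metric of constant holomorphic sectional curvature $4$. An isometric immersion into $\mathbb{H}P^n$ is totally real if the two-forms $\omega_I(X,Y)=g(IX,Y)$, $\omega_J(X,Y)=g(JX,Y)$, $\omega_K(X,Y)=g(KX,Y)$ all pull back to zero at each point; an isometric immersion into $\mathbb{C}P^{2n+1}$ is totally real if the Kähler form pulls back to zero. $\varphi$ is linearly full if its image lies in no proper quaternionic projective subspace of $\mathbb{H}P^n$. A totally real horizontal minimal lift of $\varphi$ is a totally real isometric minimal immersion $[s]:M\to\mathbb{C}P^{2n+1}$ with $s:M\to S^{4n+3}$, $\pi\circ s=\varphi$ and $\langle ds,s\rangle=\langle ds,\mathrm{j}s\rangle=0$ (such a lift always exists). Harmonic sequences and isotropy order. $\mathbb{H}P^n$ is viewed as a totally geodesic submanifold of $G(2,2n+2)$ via $\pi(q)\mapsto\mathrm{span}_{\mathbb{C}}\{q,\mathrm{j}q\}$. For a harmonic subbundle $\underline\psi=\underline\psi_0$ of $M\times\mathbb{C}^{2n+2}$, the harmonic sequence is defined by letting $\underline\psi_{k+1}$ ($k\ge0$) be the image bundle (extended across isolated points) of $A'_{\psi_k}(v)=\pi_{\psi_k^\perp}(\partial_zv)$, with $\pi_{\psi_k^\perp}$ orthogonal projection onto $\underline\psi_k^\perp$. The isotropy order of $\underline\psi$ is the greatest $r$ such that $\underline\psi_0\perp\underline\psi_i$ for all $1\le i\le r$. This applies to $\underline\varphi$ (rank 2; all $\underline\varphi_k$ in its harmonic sequence are of rank 2) and to the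 line bundle $\underline f_0=[s]$. For $\varphi$ of isotropy order $n$ the sequence is cyclic: $\underline\varphi_p\perp\underline\varphi_q$ for $0\le p<q\le n$ and $\underline\varphi_{n+1}=\underline\varphi_0$. *)

theory Defs
  imports "HOL-Analysis.Analysis"
begin

subsection \<open>Smooth maps on open sets\<close>

primrec Ck_on :: "nat \<Rightarrow> 'a::euclidean_space set \<Rightarrow> ('a \<Rightarrow> 'b::real_normed_vector) \<Rightarrow> bool" where
  "Ck_on 0 U f \<longleftrightarrow> continuous_on U f"
| "Ck_on (Suc k) U f \<longleftrightarrow> (\<forall>x\<in>U. f differentiable (at x)) \<and>
     (\<forall>b\<in>Basis. Ck_on k U (\<lambda>x. frechet_derivative f (at x) b))"

definition smooth_on :: "'a::euclidean_space set \<Rightarrow> ('a \<Rightarrow> 'b::real_normed_vector) \<Rightarrow> bool" where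
  "smooth_on U f \<longleftrightarrow> (\<forall>k. Ck_on k U f)"

abbreviation dd :: "('a::real_normed_vector \<Rightarrow> 'b::real_normed_vector) \<Rightarrow> 'a \<Rightarrow> 'a \<Rightarrow> 'b" where
  "dd f z X \<equiv> frechet_derivative f (at z) X"

subsection \<open>The quaternionic structure of complex Euclidean space\<close>

text \<open>With \<open>CARD('m) = n + 1\<close>, the type below is the space of complex (2n+2)-tuples. The
  entries at \<open>(k, 1)\<close> and \<open>(k, 2)\<close> are the complex numbers a, b of the k-th quaternionic
  coordinate a + b j. Its library inner product \<open>v \<bullet> w\<close> is the real part of \<open>herm v w\<close>.\<close>

type_synonym 'm hvec = "complex ^ ('m \<times> 2)"

definition herm :: "'m::finite hvec \<Rightarrow> 'm hvec \<Rightarrow> complex" where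
  "herm v w = (\<Sum>k\<in>UNIV. v $ k * cnj (w $ k))"

text \<open>Left multiplication by j; left multiplication by k = ij is \<open>v \<mapsto> \<i> *s jmul v\<close>.\<close>

definition jmul :: "'m::finite hvec \<Rightarrow> 'm hvec" where
  "jmul v = (\<chi> p. if snd p = 1 then - cnj (v $ (fst p, 2)) else cnj (v $ (fst p, 1)))"

lemma inner_eq_Re_herm: "v \<bullet> w = Re (herm v w)"
  by (simp add: herm_def inner_vec_def inner_complex_def)

lemma jmul_jmul: "jmul (jmul v) = - v"
  by (auto simp: jmul_def vec_eq_iff forall_2)

definition quaternionic_subspace :: "'m::finite hvec set \<Rightarrow> bool" where
  "quaternionic_subspace W \<longleftrightarrow> vec.subspace W \<and> jmul ` W \<subseteq> W"

subsection \<open>Maps into quaternionic projective space\<close>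

text \<open>A point of quaternionic projective space is a quaternionic line (a subset of the vector
  space), so that a map into it is literally a rank two subbundle of the trivial bundle.
  Here \<open>(a + b j) q = a q + b (j q)\<close>; restricted to the unit sphere \<open>hp_point\<close> is the
  Riemannian submersion \<open>\<pi>\<close>.\<close>

definition hp_point :: "'m::finite hvec \<Rightarrow> 'm hvec set" where
  "hp_point q = {a *s q + b *s jmul q | a b. True}"

definition horizontal :: "'m::finite hvec \<Rightarrow> 'm hvec \<Rightarrow> bool" where
  "horizontal q v \<longleftrightarrow> herm v q = 0 \<and> herm v (jmul q) = 0"

text \<open>Orthogonal projection onto the horizontal space at a unit vector q, for which q and jq
  are orthonormal.\<close>

definition hp_hor :: "'m::finite hvec \<Rightarrow> 'm hvec \<Rightarrow> 'm hvec" where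
  "hp_hor q v = v - herm v q *s q - herm v (jmul q) *s jmul q"

definition hp_lift :: "complex set \<Rightarrow> (complex \<Rightarrow> 'm::finite hvec set) \<Rightarrow> (complex \<Rightarrow> 'm hvec) \<Rightarrow> bool" where
  "hp_lift U \<phi> q \<longleftrightarrow> open U \<and> smooth_on U q \<and> (\<forall>z\<in>U. q z \<in> sphere 0 1 \<and> hp_point (q z) = \<phi> z)"

text \<open>Since \<open>\<pi>\<close> is a submersion, smoothness of a map means that it locally admits smooth lifts to
  the sphere. All notions below are independent of the chosen local lift (in general not
  horizontal).\<close>

definition hp_smooth :: "complex set \<Rightarrow> (complex \<Rightarrow> 'm::finite hvec set) \<Rightarrow> bool" where
  "hp_smooth M \<phi> \<longleftrightarrow> (\<forall>z\<in>M. \<exists>U q. z \<in> U \<and> U \<subseteq> M \<and> hp_lift U \<phi> q)"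

text \<open>The differential of \<open>\<phi> = \<pi> \<circ> q\<close>, with the tangent space of the projective space identified
  with the horizontal space at \<open>q z\<close>.\<close>

definition hp_diff :: "(complex \<Rightarrow> 'm::finite hvec) \<Rightarrow> complex \<Rightarrow> complex \<Rightarrow> 'm hvec" where
  "hp_diff q z X = hp_hor (q z) (dd q z X)"

text \<open>The domain carries the conformal metric \<open>lam (dx^2 + dy^2)\<close>.\<close>

definition hp_isometric :: "complex set \<Rightarrow> (complex \<Rightarrow> real) \<Rightarrow> (complex \<Rightarrow> 'm::finite hvec set) \<Rightarrow> bool" where
  "hp_isometric M lam \<phi> \<longleftrightarrow> (\<forall>U q. U \<subseteq> M \<and> hp_lift U \<phi> q \<longrightarrow>
     (\<forall>z\<in>U. \<forall>X Y. hp_diff q z X \<bullet> hp_diff q z Y = lam z * (X \<bullet> Y)))"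

definition hp_totally_real :: "complex set \<Rightarrow> (complex \<Rightarrow> 'm::finite hvec set) \<Rightarrow> bool" where
  "hp_totally_real M \<phi> \<longleftrightarrow> (\<forall>U q. U \<subseteq> M \<and> hp_lift U \<phi> q \<longrightarrow>
     (\<forall>z\<in>U. \<forall>X Y.
        (\<i> *s hp_diff q z X) \<bullet> hp_diff q z Y = 0 \<and>
        jmul (hp_diff q z X) \<bullet> hp_diff q z Y = 0 \<and>
        (\<i> *s jmul (hp_diff q z X)) \<bullet> hp_diff q z Y = 0))"

text \<open>Covariant derivative (Levi-Civita connection of the submersion metric, pulled back along
  \<open>\<phi> = \<pi> \<circ> q\<close>) of a vector field along \<open>\<phi>\<close> given by its horizontal representative V.
  If the differential of q in direction X is horizontal, this is O'Neill's formula: the horizontal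
  part of the derivative of V. In general the vertical part of that differential is \<open>p q\<close> for the
  quaternion p = \<open>herm (dd q z X) (q z) + herm (dd q z X) (jmul (q z))\<close> j, and the correction
  \<open>- p V\<close> accounts for the rotation of the frame q (the tangent space at a line L is
  the space of H-linear maps from L to its orthogonal complement, V being the image of q).\<close>

definition hp_cov ::
  "(complex \<Rightarrow> 'm::finite hvec) \<Rightarrow> (complex \<Rightarrow> 'm hvec) \<Rightarrow> complex \<Rightarrow> complex \<Rightarrow> 'm hvec" where
  "hp_cov q V z X = hp_hor (q z) (dd V z X)
     - (herm (dd q z X) (q z) *s V z + herm (dd q z X) (jmul (q z)) *s jmul (V z))"

text \<open>Tension field: trace of the second fundamental form of the map. The coordinate is isothermal,
  so the Christoffel symbols of the domain cancel in the trace.\<close>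

definition hp_tension :: "(complex \<Rightarrow> real) \<Rightarrow> (complex \<Rightarrow> 'm::finite hvec) \<Rightarrow> complex \<Rightarrow> 'm hvec" where
  "hp_tension lam q z = (1 / lam z) *\<^sub>R
     (hp_cov q (\<lambda>w. hp_diff q w 1) z 1 + hp_cov q (\<lambda>w. hp_diff q w \<i>) z \<i>)"

definition hp_harmonic :: "complex set \<Rightarrow> (complex \<Rightarrow> real) \<Rightarrow> (complex \<Rightarrow> 'm::finite hvec set) \<Rightarrow> bool" where
  "hp_harmonic M lam \<phi> \<longleftrightarrow> (\<forall>U q. U \<subseteq> M \<and> hp_lift U \<phi> q \<longrightarrow> (\<forall>z\<in>U. hp_tension lam q z = 0))"

definition hp_linearly_full :: "complex set \<Rightarrow> (complex \<Rightarrow> 'm::finite hvec set) \<Rightarrow> bool" where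
  "hp_linearly_full M \<phi> \<longleftrightarrow>
     \<not> (\<exists>W. quaternionic_subspace W \<and> W \<noteq> UNIV \<and> (\<forall>z\<in>M. \<phi> z \<subseteq> W))"

subsection \<open>Maps into complex projective space\<close>

text \<open>A map into complex projective space is given by a lift s to the unit sphere. The Fubini-Study
  metric of constant holomorphic sectional curvature 4 is the one that makes the Hopf fibration
  \<open>cp_point\<close> from the unit sphere a Riemannian submersion, so everything is the complex analogue of
  the quaternionic definitions above.\<close>

definition cp_point :: "'m::finite hvec \<Rightarrow> 'm hvec set" where
  "cp_point q = {a *s q | a. True}"

definition cp_hor :: "'m::finite hvec \<Rightarrow> 'm hvec \<Rightarrow> 'm hvec" where
  "cp_hor q v = v - herm v q *s q"

definition cp_diff :: "(complex \<Rightarrow> 'm::finite hvec) \<Rightarrow> complex \<Rightarrow> complex \<Rightarrow> 'm hvec" where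
  "cp_diff s z X = cp_hor (s z) (dd s z X)"

definition cp_cov ::
  "(complex \<Rightarrow> 'm::finite hvec) \<Rightarrow> (complex \<Rightarrow> 'm hvec) \<Rightarrow> complex \<Rightarrow> complex \<Rightarrow> 'm hvec" where
  "cp_cov s V z X = cp_hor (s z) (dd V z X) - herm (dd s z X) (s z) *s V z"

definition cp_isometric :: "complex set \<Rightarrow> (complex \<Rightarrow> real) \<Rightarrow> (complex \<Rightarrow> 'm::finite hvec) \<Rightarrow> bool" where
  "cp_isometric M lam s \<longleftrightarrow>
     (\<forall>z\<in>M. \<forall>X Y. cp_diff s z X \<bullet> cp_diff s z Y = lam z * (X \<bullet> Y))"

definition cp_totally_real :: "complex set \<Rightarrow> (complex \<Rightarrow> 'm::finite hvec) \<Rightarrow> bool" where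
  "cp_totally_real M s \<longleftrightarrow>
     (\<forall>z\<in>M. \<forall>X Y. (\<i> *s cp_diff s z X) \<bullet> cp_diff s z Y = 0)"

text \<open>Minimality of an isometric immersion: the mean curvature vector vanishes, that is, the trace of
  the covariant derivative of the differential has no component normal to the image of the
  differential.\<close>

definition cp_minimal :: "complex set \<Rightarrow> (complex \<Rightarrow> real) \<Rightarrow> (complex \<Rightarrow> 'm::finite hvec) \<Rightarrow> bool" where
  "cp_minimal M lam s \<longleftrightarrow> (\<forall>z\<in>M.
     (1 / lam z) *\<^sub>R (cp_cov s (\<lambda>w. cp_diff s w 1) z 1 + cp_cov s (\<lambda>w. cp_diff s w \<i>) z \<i>)
       \<in> range (cp_diff s z))"

definition totally_real_horizontal_minimal_lift ::
  "complex set \<Rightarrow> (complex \<Rightarrow> real) \<Rightarrow> (complex \<Rightarrow> 'm::finite hvec set) \<Rightarrow> (complex \<Rightarrow> 'm hvec) \<Rightarrow> bool" where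
  "totally_real_horizontal_minimal_lift M lam \<phi> s \<longleftrightarrow>
     hp_lift M \<phi> s \<and>
     (\<forall>z\<in>M. \<forall>X. horizontal (s z) (dd s z X)) \<and>
     cp_isometric M lam s \<and> cp_totally_real M s \<and> cp_minimal M lam s"

subsection \<open>Harmonic sequences and isotropy order\<close>

text \<open>A subbundle \<open>\<psi>\<close> of the trivial bundle assigns to each point its fibre.\<close>

definition dz :: "(complex \<Rightarrow> 'm::finite hvec) \<Rightarrow> complex \<Rightarrow> 'm hvec" where
  "dz v z = (1/2) *s (dd v z 1 - \<i> *s dd v z \<i>)"

definition local_section :: "complex set \<Rightarrow> (complex \<Rightarrow> 'm::finite hvec set) \<Rightarrow> (complex \<Rightarrow> 'm hvec) \<Rightarrow> bool" where
  "local_section U \<psi> v \<longleftrightarrow> open U \<and> smooth_on U v \<and> (\<forall>w\<in>U. v w \<in> \<psi> w)"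

definition proj_perp :: "'m::finite hvec set \<Rightarrow> 'm hvec \<Rightarrow> 'm hvec" where
  "proj_perp W u = u - closest_point W u"

text \<open>The image of the fibre at w under \<open>A'\<^sub>\<psi>\<close>.\<close>

definition A'_image :: "(complex \<Rightarrow> 'm::finite hvec set) \<Rightarrow> complex \<Rightarrow> 'm hvec set" where
  "A'_image \<psi> w = {proj_perp (\<psi> w) (dz v w) | v. \<exists>U. w \<in> U \<and> local_section U \<psi> v}"

text \<open>The image bundle, extended across isolated points: the fibre at z is the limit, as w tends
  to z, of the images at w, i.e. it consists of the vectors whose distance to the image at w tends
  to 0. Where the images form a smooth bundle near z this is just the image at z; where they do so
  only on a punctured neighbourhood, it is the fibre of the continuous extension.\<close>

definition next_bundle :: "(complex \<Rightarrow> 'm::finite hvec set) \<Rightarrow> complex \<Rightarrow> 'm hvec set" where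
  "next_bundle \<psi> z = {v. ((\<lambda>w. infdist v (A'_image \<psi> w)) \<longlongrightarrow> 0) (at z)}"

primrec harmonic_sequence ::
  "(complex \<Rightarrow> 'm::finite hvec set) \<Rightarrow> nat \<Rightarrow> complex \<Rightarrow> 'm hvec set" where
  "harmonic_sequence \<psi> 0 = \<psi>"
| "harmonic_sequence \<psi> (Suc k) = next_bundle (harmonic_sequence \<psi> k)"

definition perp_bundles ::
  "complex set \<Rightarrow> (complex \<Rightarrow> 'm::finite hvec set) \<Rightarrow> (complex \<Rightarrow> 'm hvec set) \<Rightarrow> bool" where
  "perp_bundles M \<psi> \<psi>2 \<longleftrightarrow> (\<forall>z\<in>M. \<forall>u\<in>\<psi> z. \<forall>v\<in>\<psi>2 z. herm u v = 0)"

definition isotropic_up_to :: "complex set \<Rightarrow> (complex \<Rightarrow> 'm::finite hvec set) \<Rightarrow> nat \<Rightarrow> bool" where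
  "isotropic_up_to M \<psi> r \<longleftrightarrow>
     (\<forall>i\<in>{1..r}. perp_bundles M (harmonic_sequence \<psi> 0) (harmonic_sequence \<psi> i))"

text \<open>The greatest r need not exist (e.g. when the sequence terminates in the zero bundle); then the
  isotropy order is no natural number and the predicate is false for every r.\<close>

definition isotropy_order :: "complex set \<Rightarrow> (complex \<Rightarrow> 'm::finite hvec set) \<Rightarrow> nat \<Rightarrow> bool" where
  "isotropy_order M \<psi> r \<longleftrightarrow>
     isotropic_up_to M \<psi> r \<and> (\<forall>r'. isotropic_up_to M \<psi> r' \<longrightarrow> r' \<le> r)"

end

theory Submission
  imports Defs "HOL-Complex_Analysis.Conformal_Mappings"
begin

text \<open>Let \<open>v\<^sub>0 = s, v\<^sub>1, v\<^sub>2, \<dots>\<close> span the harmonic sequence of [s], each \<open>v\<^sub>k\<^sub>+\<^sub>1\<close> being the derivative of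
  \<open>v\<^sub>k\<close> projected off \<open>v\<^sub>k\<close>, and let \<open>v\<^sub>-\<^sub>k\<close> be formed in the same way with the conjugate derivative. Since s is
  horizontal, the bundle \<open>\<phi>\<^sub>k\<close> is spanned by the orthogonal sections \<open>v\<^sub>k\<close> and \<open>j v\<^sub>-\<^sub>k\<close> for k up to n + 1.
  Isotropy of \<open>\<phi>\<close> makes \<open>\<langle>v\<^sub>n\<^sub>+\<^sub>1, s\<rangle>\<close> and \<open>\<langle>v\<^sub>n\<^sub>+\<^sub>1, j s\<rangle>\<close> holomorphic, and not all of these functions and of their
  counterparts for \<open>v\<^sub>-\<^sub>n\<^sub>-\<^sub>1\<close> vanish. If \<open>\<langle>v\<^sub>n\<^sub>+\<^sub>1, s\<rangle>\<close> is not zero, then [s] has isotropy order n.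
  Otherwise counting dimensions shows that \<open>v\<^sub>n\<^sub>+\<^sub>1\<close> and \<open>v\<^sub>-\<^sub>n\<^sub>-\<^sub>1\<close> are multiples of j s. They have the same norm,
  since \<open>|v\<^sub>k|\<close> and \<open>|v\<^sub>-\<^sub>k|\<close> solve the same Toda equations with the same initial values; hence neither is zero,
  and the harmonic sequence continues with [j s], \<open>[j v\<^sub>-\<^sub>1]\<close>, ..., \<open>[j v\<^sub>-\<^sub>n\<^sub>-\<^sub>1]\<close> = [s], which has index 2n + 2.

  The sections may have zeros, across which they need not extend as a frame. This does not
  matter: everything is computed on open sets where each section vanishes identically or nowhere,
  whose union is dense, and is carried over to the whole domain by continuity or by the identity
  theorem.\<close>

subsection \<open>Calculus of smooth maps\<close>

lemma dd_eqI: "(f has_derivative f') (at z) \<Longrightarrow> dd f z X = f' X"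
  using frechet_derivative_at by metis

text \<open>\<open>frechet_derivative\<close> is a choice among all derivatives, and f and g have
  the same ones at z; hence no differentiability is assumed.\<close>

lemma dd_cong_open:
  assumes "open U" "z \<in> U" "\<And>x. x \<in> U \<Longrightarrow> f x = g x"
  shows "dd f z = dd g z"
proof -
  have "(f has_derivative f') (at z) = (g has_derivative f') (at z)" for f'
    using has_derivative_transform_within_open[OF _ assms(1,2), of f f' UNIV g]
      has_derivative_transform_within_open[OF _ assms(1,2), of g f' UNIV f] assms(3) by auto
  then show ?thesis unfolding frechet_derivative_def by presburger
qed

lemma Ck_on_cong:
  assumes "open U" "\<And>x. x \<in> U \<Longrightarrow> f x = g x"
  shows "Ck_on k U f \<longleftrightarrow> Ck_on k U g"
  using assms
proof (induction k arbitrary: f g)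
  case 0
  then show ?case by (simp cong: continuous_on_cong)
next
  case (Suc k)
  have "f differentiable (at x) \<longleftrightarrow> g differentiable (at x)" if "x \<in> U" for x
    unfolding differentiable_def
    using has_derivative_transform_within_open[OF _ Suc.prems(1) that, of f _ UNIV g]
      has_derivative_transform_within_open[OF _ Suc.prems(1) that, of g _ UNIV f] Suc.prems(2)
    by auto
  moreover have "Ck_on k U (\<lambda>x. dd f x b) \<longleftrightarrow> Ck_on k U (\<lambda>x. dd g x b)" for b
    by (intro Suc.IH Suc.prems(1)) (simp add: dd_cong_open[OF Suc.prems(1) _ Suc.prems(2)])
  ultimately show ?case by simp
qed

lemma Ck_on_subset: "Ck_on k U f \<Longrightarrow> V \<subseteq> U \<Longrightarrow> Ck_on k V f"
  by (induction k arbitrary: f) (auto intro: continuous_on_subset)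

lemma Ck_on_SucD: "Ck_on (Suc k) U f \<Longrightarrow> Ck_on k U f"
proof (induction k arbitrary: f)
  case 0
  then show ?case
    by (auto intro!: differentiable_imp_continuous_on differentiable_at_imp_differentiable_on)
next
  case (Suc k)
  then show ?case by simp
qed

lemma Ck_on_const: "Ck_on k U (\<lambda>x. c)"
  by (induction k arbitrary: c) auto

lemma Ck_on_linear:
  assumes "bounded_linear L" "open U" "Ck_on k U f"
  shows "Ck_on k U (\<lambda>x. L (f x))"
  using assms(3)
proof (induction k arbitrary: f)
  case 0
  then show ?case
    by (simp add: bounded_linear.continuous_on[OF assms(1)])
next
  case (Suc k)
  have *: "((\<lambda>x. L (f x)) has_derivative (\<lambda>h. L (dd f x h))) (at x)" if "x \<in> U" for x
    using Suc.prems that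
    by (intro bounded_linear.has_derivative[OF assms(1)]) (simp add: frechet_derivative_works)
  have "Ck_on k U (\<lambda>x. dd (\<lambda>x. L (f x)) x b)" if "b \<in> Basis" for b
    using Suc.IH[of "\<lambda>x. dd f x b"] Suc.prems that
    by (subst Ck_on_cong[OF assms(2), of _ "\<lambda>x. L (dd f x b)"]) (auto simp: dd_eqI[OF *])
  then show ?case using * unfolding Ck_on.simps differentiable_def by blast
qed

lemma Ck_on_add:
  assumes "open U" "Ck_on k U f" "Ck_on k U g"
  shows "Ck_on k U (\<lambda>x. f x + g x)"
  using assms(2,3)
proof (induction k arbitrary: f g)
  case 0
  then show ?case by (simp add: continuous_on_add)
next
  case (Suc k)
  have *: "((\<lambda>x. f x + g x) has_derivative (\<lambda>h. dd f x h + dd g x h)) (at x)" if "x \<in> U" for x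
    using Suc.prems that by (intro has_derivative_add) (simp_all add: frechet_derivative_works)
  have "Ck_on k U (\<lambda>x. dd (\<lambda>x. f x + g x) x b)" if "b \<in> Basis" for b
    using Suc.IH[of "\<lambda>x. dd f x b" "\<lambda>x. dd g x b"] Suc.prems that
    by (subst Ck_on_cong[OF assms(1), of _ "\<lambda>x. dd f x b + dd g x b"]) (auto simp: dd_eqI[OF *])
  then show ?case using * unfolding Ck_on.simps differentiable_def by blast
qed

text \<open>In each summand of the product rule one factor stays undifferentiated;
  \<open>Ck_on_SucD\<close> lowers its order to k. Scalar and Hermitian products are
  instances.\<close>

lemma Ck_on_bilinear:
  assumes "bounded_bilinear B" "open U" "Ck_on k U f" "Ck_on k U g"
  shows "Ck_on k U (\<lambda>x. B (f x) (g x))"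
  using assms(3,4)
proof (induction k arbitrary: f g)
  case 0
  then show ?case by (simp add: bounded_bilinear.continuous_on[OF assms(1)])
next
  case (Suc k)
  have *: "((\<lambda>x. B (f x) (g x)) has_derivative (\<lambda>h. B (f x) (dd g x h) + B (dd f x h) (g x))) (at x)"
    if "x \<in> U" for x
    using Suc.prems that
    by (intro bounded_bilinear.FDERIV[OF assms(1)]) (simp_all add: frechet_derivative_works)
  have "Ck_on k U (\<lambda>x. dd (\<lambda>x. B (f x) (g x)) x b)" if "b \<in> Basis" for b
  proof -
    have "Ck_on k U (\<lambda>x. B (f x) (dd g x b) + B (dd f x b) (g x))"
      using Suc.prems that Ck_on_SucD[OF Suc.prems(1)] Ck_on_SucD[OF Suc.prems(2)]
      by (intro Ck_on_add[OF assms(2)] Suc.IH) auto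
    then show ?thesis
      by (subst Ck_on_cong[OF assms(2)]) (auto simp: dd_eqI[OF *])
  qed
  then show ?case using * unfolding Ck_on.simps differentiable_def by blast
qed

text \<open>The derivative of 1/f is built from 1/f and the derivative of f, so the induction on k
  runs with f fixed.\<close>

lemma Ck_on_inverse:
  fixes f :: "'a::euclidean_space \<Rightarrow> 'b::real_normed_field"
  assumes "open U" "Ck_on k U f" "\<And>x. x \<in> U \<Longrightarrow> f x \<noteq> 0"
  shows "Ck_on k U (\<lambda>x. inverse (f x))"
  using assms(2)
proof (induction k)
  case 0
  then show ?case using assms(3) by (auto intro: continuous_on_inverse)
next
  case (Suc k)
  have *: "((\<lambda>x. inverse (f x)) has_derivative (\<lambda>h. - (inverse (f x) * dd f x h * inverse (f x)))) (at x)"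
    if "x \<in> U" for x
    using Suc.prems that assms(3)
    by (intro Deriv.has_derivative_inverse) (simp_all add: frechet_derivative_works)
  have "Ck_on k U (\<lambda>x. dd (\<lambda>x. inverse (f x)) x b)" if "b \<in> Basis" for b
  proof -
    have "Ck_on k U (\<lambda>x. - (inverse (f x) * dd f x b * inverse (f x)))"
      using Suc.IH[OF Ck_on_SucD[OF Suc.prems]] Suc.prems that
      by (intro Ck_on_linear[OF bounded_linear_minus[OF bounded_linear_ident]]
          Ck_on_bilinear[OF bounded_bilinear_mult] assms(1)) auto
    then show ?thesis
      by (subst Ck_on_cong[OF assms(1)]) (auto simp: dd_eqI[OF *])
  qed
  then show ?case using * unfolding Ck_on.simps differentiable_def by blast
qed

lemma smooth_on_cong:
  "open U \<Longrightarrow> (\<And>x. x \<in> U \<Longrightarrow> f x = g x) \<Longrightarrow> smooth_on U f \<longleftrightarrow> smooth_on U g"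
  unfolding smooth_on_def using Ck_on_cong by blast

lemma smooth_on_subset: "smooth_on U f \<Longrightarrow> V \<subseteq> U \<Longrightarrow> smooth_on V f"
  unfolding smooth_on_def using Ck_on_subset by blast

lemma smooth_on_const: "smooth_on U (\<lambda>x. c)"
  unfolding smooth_on_def using Ck_on_const by blast

lemma smooth_on_linear: "bounded_linear L \<Longrightarrow> open U \<Longrightarrow> smooth_on U f \<Longrightarrow> smooth_on U (\<lambda>x. L (f x))"
  unfolding smooth_on_def using Ck_on_linear by blast

lemma smooth_on_add: "open U \<Longrightarrow> smooth_on U f \<Longrightarrow> smooth_on U g \<Longrightarrow> smooth_on U (\<lambda>x. f x + g x)"
  unfolding smooth_on_def using Ck_on_add by blast

lemma smooth_on_minus: "open U \<Longrightarrow> smooth_on U f \<Longrightarrow> smooth_on U (\<lambda>x. - f x)"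
  by (rule smooth_on_linear[OF bounded_linear_minus[OF bounded_linear_ident]])

lemma smooth_on_diff: "open U \<Longrightarrow> smooth_on U f \<Longrightarrow> smooth_on U g \<Longrightarrow> smooth_on U (\<lambda>x. f x - g x)"
  using smooth_on_add[OF _ _ smooth_on_minus, of U f g] by simp

lemma smooth_on_bilinear:
  "bounded_bilinear B \<Longrightarrow> open U \<Longrightarrow> smooth_on U f \<Longrightarrow> smooth_on U g \<Longrightarrow> smooth_on U (\<lambda>x. B (f x) (g x))"
  unfolding smooth_on_def using Ck_on_bilinear by blast

lemma smooth_on_mult:
  fixes f g :: "'a::euclidean_space \<Rightarrow> 'b::real_normed_algebra"
  shows "open U \<Longrightarrow> smooth_on U f \<Longrightarrow> smooth_on U g \<Longrightarrow> smooth_on U (\<lambda>x. f x * g x)"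
  by (rule smooth_on_bilinear[OF bounded_bilinear_mult])

lemma smooth_on_divide:
  fixes f g :: "'a::euclidean_space \<Rightarrow> 'b::real_normed_field"
  assumes "open U" "smooth_on U f" "smooth_on U g" "\<And>x. x \<in> U \<Longrightarrow> g x \<noteq> 0"
  shows "smooth_on U (\<lambda>x. f x / g x)"
proof -
  have "smooth_on U (\<lambda>x. inverse (g x))"
    using assms Ck_on_inverse unfolding smooth_on_def by blast
  from smooth_on_mult[OF assms(1,2) this] show ?thesis by (simp add: divide_inverse)
qed

lemma smooth_on_dd: "smooth_on U f \<Longrightarrow> b \<in> Basis \<Longrightarrow> smooth_on U (\<lambda>x. dd f x b)"
  unfolding smooth_on_def using Ck_on.simps(2) by blast

lemma smooth_on_imp_continuous_on: "smooth_on U f \<Longrightarrow> continuous_on U f"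
  unfolding smooth_on_def by (metis Ck_on.simps(1))

lemma smooth_on_has_derivative:
  "smooth_on U f \<Longrightarrow> x \<in> U \<Longrightarrow> (f has_derivative dd f x) (at x)"
  unfolding smooth_on_def by (metis Ck_on.simps(2) frechet_derivative_works)

section \<open>Symmetry of second derivatives\<close>

lemma mixed_difference:
  fixes f :: "'a::real_normed_vector \<Rightarrow> real"
  assumes f: "\<And>p. p \<in> ball z r \<Longrightarrow> (f has_derivative f' p) (at p)"
    and f': "\<And>p. p \<in> ball z r \<Longrightarrow> ((\<lambda>q. f' q a) has_derivative f'' p) (at p)"
    and h: "0 < h" "h * (norm a + norm b) < r"
  shows "\<exists>t s. 0 < t \<and> t < h \<and> 0 < s \<and> s < h \<and>
    f (z + h *\<^sub>R a + h *\<^sub>R b) - f (z + h *\<^sub>R a) - f (z + h *\<^sub>R b) + f z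
      = h * h * f'' (z + t *\<^sub>R a + s *\<^sub>R b) b"
proof -
  have inb: "z + t *\<^sub>R a + s *\<^sub>R b \<in> ball z r" if "0 \<le> t" "t \<le> h" "0 \<le> s" "s \<le> h" for t s
  proof -
    have "norm (t *\<^sub>R a + s *\<^sub>R b) \<le> t * norm a + s * norm b"
      using norm_triangle_ineq[of "t *\<^sub>R a" "s *\<^sub>R b"] that by simp
    also have "\<dots> \<le> h * norm a + h * norm b" using that by (intro add_mono mult_right_mono) auto
    finally have "norm (t *\<^sub>R a + s *\<^sub>R b) < r" using h(2) by (simp add: distrib_left)
    moreover have "dist z (z + t *\<^sub>R a + s *\<^sub>R b) = norm (t *\<^sub>R a + s *\<^sub>R b)"
      by (simp add: dist_norm norm_minus_commute algebra_simps)
    ultimately show ?thesis by simp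
  qed
  have line_a: "((\<lambda>t. f (z + t *\<^sub>R a + s *\<^sub>R b)) has_real_derivative f' (z + t *\<^sub>R a + s *\<^sub>R b) a) (at t)"
    if "0 \<le> t" "t \<le> h" "0 \<le> s" "s \<le> h" for t s
  proof -
    have "((\<lambda>t. z + t *\<^sub>R a + s *\<^sub>R b) has_derivative (\<lambda>x. x *\<^sub>R a)) (at t)"
      by (auto intro!: derivative_eq_intros)
    from has_derivative_compose[OF this f[OF inb[OF that]]]
    have "((\<lambda>t. f (z + t *\<^sub>R a + s *\<^sub>R b)) has_derivative (\<lambda>x. f' (z + t *\<^sub>R a + s *\<^sub>R b) (x *\<^sub>R a))) (at t)" .
    moreover have "linear (f' (z + t *\<^sub>R a + s *\<^sub>R b))"
      using f[OF inb[OF that]] has_derivative_linear by blast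
    ultimately show ?thesis by (simp add: has_field_derivative_def linear_scale mult.commute[of _ "f' _ _"] mult_commute_abs)
  qed
  have line_b: "((\<lambda>s. f' (z + t *\<^sub>R a + s *\<^sub>R b) a) has_real_derivative f'' (z + t *\<^sub>R a + s *\<^sub>R b) b) (at s)"
    if "0 \<le> t" "t \<le> h" "0 \<le> s" "s \<le> h" for t s
  proof -
    have "((\<lambda>s. z + t *\<^sub>R a + s *\<^sub>R b) has_derivative (\<lambda>x. x *\<^sub>R b)) (at s)"
      by (auto intro!: derivative_eq_intros)
    from has_derivative_compose[OF this f'[OF inb[OF that]]]
    have "((\<lambda>s. f' (z + t *\<^sub>R a + s *\<^sub>R b) a) has_derivative (\<lambda>x. f'' (z + t *\<^sub>R a + s *\<^sub>R b) (x *\<^sub>R b))) (at s)" .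
    moreover have "linear (f'' (z + t *\<^sub>R a + s *\<^sub>R b))"
      using f'[OF inb[OF that]] has_derivative_linear by blast
    ultimately show ?thesis by (simp add: has_field_derivative_def linear_scale mult_commute_abs)
  qed
  \<comment> \<open>The mean value theorem in direction a, applied to the increment of f in
    direction b; the increment in b is then treated likewise. The zero coefficients keep all points
    in the shape that \<open>line_a\<close> expects.\<close>
  have "\<exists>t>0. t < h \<and> (f (z + h *\<^sub>R a + h *\<^sub>R b) - f (z + h *\<^sub>R a + 0 *\<^sub>R b)) -
      (f (z + 0 *\<^sub>R a + h *\<^sub>R b) - f (z + 0 *\<^sub>R a + 0 *\<^sub>R b))
      = (h - 0) * (f' (z + t *\<^sub>R a + h *\<^sub>R b) a - f' (z + t *\<^sub>R a + 0 *\<^sub>R b) a)"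
    by (rule MVT2[OF h(1)]) (use h in \<open>intro DERIV_diff line_a; simp\<close>)
  then obtain t where t: "0 < t" "t < h" 
    "(f (z + h *\<^sub>R a + h *\<^sub>R b) - f (z + h *\<^sub>R a)) - (f (z + h *\<^sub>R b) - f z)
      = h * (f' (z + t *\<^sub>R a + h *\<^sub>R b) a - f' (z + t *\<^sub>R a + 0 *\<^sub>R b) a)" by auto
  have "\<exists>s>0. s < h \<and> f' (z + t *\<^sub>R a + h *\<^sub>R b) a - f' (z + t *\<^sub>R a + 0 *\<^sub>R b) a
      = (h - 0) * f'' (z + t *\<^sub>R a + s *\<^sub>R b) b"
    by (rule MVT2[OF h(1)]) (use t in \<open>intro line_b; simp\<close>)
  then obtain s where "0 < s" "s < h" "f' (z + t *\<^sub>R a + h *\<^sub>R b) a - f' (z + t *\<^sub>R a + 0 *\<^sub>R b) a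
      = h * f'' (z + t *\<^sub>R a + s *\<^sub>R b) b" by auto
  then show ?thesis using t by (intro exI[of _ t] exI[of _ s]) auto
qed

text \<open>The second difference over a small parallelogram is symmetric in a and b, and
  \<open>mixed_difference\<close> turns it into a value of either mixed derivative near z.
  Continuity at z excludes different values there.\<close>

lemma mixed_partials_real:
  fixes f :: "'a::euclidean_space \<Rightarrow> real"
  assumes U: "open U" "z \<in> U" and f: "smooth_on U f" and ab: "a \<in> Basis" "b \<in> Basis"
  shows "dd (\<lambda>p. dd f p a) z b = dd (\<lambda>p. dd f p b) z a"
proof (rule ccontr)
  define F where "F = (\<lambda>p. dd (\<lambda>p. dd f p a) p b)"
  define G where "G = (\<lambda>p. dd (\<lambda>p. dd f p b) p a)"
  assume "\<not> ?thesis"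
  then have "F z - G z \<noteq> 0" by (simp add: F_def G_def)
  have cont: "continuous_on U F" "continuous_on U G"
    unfolding F_def G_def using f ab by (auto intro!: smooth_on_imp_continuous_on smooth_on_dd)
  define e where "e = \<bar>F z - G z\<bar> / 2"
  have "e > 0" using \<open>F z - G z \<noteq> 0\<close> by (simp add: e_def)
  obtain d1 where d1: "d1 > 0" "\<And>x. x \<in> U \<Longrightarrow> dist x z < d1 \<Longrightarrow> dist (F x) (F z) < e"
    using cont(1) U(2) \<open>e > 0\<close> unfolding continuous_on_iff by metis
  obtain d2 where d2: "d2 > 0" "\<And>x. x \<in> U \<Longrightarrow> dist x z < d2 \<Longrightarrow> dist (G x) (G z) < e"
    using cont(2) U(2) \<open>e > 0\<close> unfolding continuous_on_iff by metis
  obtain d3 where d3: "d3 > 0" "ball z d3 \<subseteq> U" using U open_contains_ball by blast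
  define r where "r = min d1 (min d2 d3)"
  have r: "r > 0" "ball z r \<subseteq> U" using d1 d2 d3 by (auto simp: r_def)
  \<comment> \<open>Since a and b are unit vectors, \<open>h * (norm a + norm b)\<close> is
    2r/3.\<close>
  define h where "h = r / 3"
  have nab: "norm a = 1" "norm b = 1" using ab by auto
  have h: "0 < h" "h * (norm a + norm b) < r" "h * (norm b + norm a) < r"
    using r by (auto simp: h_def nab)
  have near: "z + t *\<^sub>R x + s *\<^sub>R y \<in> ball z r" 
    if "0 < t" "t < h" "0 < s" "s < h" "norm x = 1" "norm y = 1" for t s x y
  proof -
    have "norm (t *\<^sub>R x + s *\<^sub>R y) \<le> t + s"
      using norm_triangle_ineq[of "t *\<^sub>R x" "s *\<^sub>R y"] that by simp
    then have "norm (t *\<^sub>R x + s *\<^sub>R y) < r" using that r by (simp add: h_def)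
    moreover have "dist z (z + t *\<^sub>R x + s *\<^sub>R y) = norm (t *\<^sub>R x + s *\<^sub>R y)"
      by (simp add: dist_norm norm_minus_commute algebra_simps)
    ultimately show ?thesis by simp
  qed
  have D1: "(f has_derivative dd f p) (at p)" if "p \<in> ball z r" for p
    using smooth_on_has_derivative[OF f] that r by blast
  have D2: "((\<lambda>q. dd f q c) has_derivative dd (\<lambda>q. dd f q c) p) (at p)"
    if "p \<in> ball z r" "c \<in> Basis" for p c
    using smooth_on_has_derivative[OF smooth_on_dd[OF f]] that r by blast
  obtain t s where ts: "0 < t" "t < h" "0 < s" "s < h"
    "f (z + h *\<^sub>R a + h *\<^sub>R b) - f (z + h *\<^sub>R a) - f (z + h *\<^sub>R b) + f z
      = h * h * F (z + t *\<^sub>R a + s *\<^sub>R b)"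
    using mixed_difference[OF D1 D2[OF _ ab(1)] h(1,2)] unfolding F_def by blast
  obtain t' s' where ts': "0 < t'" "t' < h" "0 < s'" "s' < h"
    "f (z + h *\<^sub>R b + h *\<^sub>R a) - f (z + h *\<^sub>R b) - f (z + h *\<^sub>R a) + f z
      = h * h * G (z + t' *\<^sub>R b + s' *\<^sub>R a)"
    using mixed_difference[OF D1 D2[OF _ ab(2)] h(1,3)] unfolding G_def by blast
  have "h * h * F (z + t *\<^sub>R a + s *\<^sub>R b) = h * h * G (z + t' *\<^sub>R b + s' *\<^sub>R a)"
    using ts(5) ts'(5) add.commute[of "z + h *\<^sub>R a" "h *\<^sub>R b"]
    by (simp only: add.assoc add.commute[of "h *\<^sub>R b" "h *\<^sub>R a"])
  then have eq: "F (z + t *\<^sub>R a + s *\<^sub>R b) = G (z + t' *\<^sub>R b + s' *\<^sub>R a)" using h(1) by simp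
  have "p \<in> U \<and> dist p z < d1 \<and> dist p z < d2" if "p \<in> ball z r" for p
    using that r(2) by (auto simp: r_def dist_commute)
  moreover have "z + t *\<^sub>R a + s *\<^sub>R b \<in> ball z r" "z + t' *\<^sub>R b + s' *\<^sub>R a \<in> ball z r"
    using near ts ts' nab by blast+
  ultimately have "dist (F (z + t *\<^sub>R a + s *\<^sub>R b)) (F z) < e" "dist (G (z + t' *\<^sub>R b + s' *\<^sub>R a)) (G z) < e"
    using d1(2) d2(2) by blast+
  then have "\<bar>F z - G z\<bar> < 2 * e" unfolding eq dist_real_def by linarith
  then show False by (simp add: e_def)
qed

lemma mixed_partials:
  fixes f :: "'a::euclidean_space \<Rightarrow> 'b::euclidean_space"
  assumes U: "open U" "z \<in> U" and f: "smooth_on U f" and ab: "a \<in> Basis" "b \<in> Basis"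
  shows "dd (\<lambda>p. dd f p a) z b = dd (\<lambda>p. dd f p b) z a"
proof (rule euclidean_eqI)
  fix c :: 'b
  have *: "dd g p x \<bullet> c = dd (\<lambda>p. g p \<bullet> c) p x" if "smooth_on U g" "p \<in> U" for g p x
    by (rule dd_eqI[symmetric], rule has_derivative_inner_left)
      (rule smooth_on_has_derivative[OF that])
  have fc: "smooth_on U (\<lambda>p. f p \<bullet> c)"
    by (rule smooth_on_linear[OF bounded_linear_inner_left U(1) f])
  have "dd (\<lambda>p. dd f p x) z y \<bullet> c = dd (\<lambda>p. dd (\<lambda>p. f p \<bullet> c) p x) z y" if "x \<in> Basis" for x y
    using dd_cong_open[OF U, of "\<lambda>p. dd f p x \<bullet> c" "\<lambda>p. dd (\<lambda>p. f p \<bullet> c) p x"]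
    by (simp add: *[OF smooth_on_dd[OF f that] U(2)] *[OF f])
  then show "dd (\<lambda>p. dd f p a) z b \<bullet> c = dd (\<lambda>p. dd f p b) z a \<bullet> c"
    using mixed_partials_real[OF U fc ab] ab by simp
qed

subsection \<open>The Hermitian product and the Wirtinger operators\<close>

lemma herm_add_left: "herm (u + v) w = herm u w + herm v w"
  by (simp add: herm_def algebra_simps sum.distrib)

lemma herm_add_right: "herm w (u + v) = herm w u + herm w v"
  by (simp add: herm_def algebra_simps sum.distrib)

lemma herm_scale_left: "herm (c *s u) w = c * herm u w"
  by (simp add: herm_def sum_distrib_left mult.assoc)

lemma herm_scale_right: "herm u (c *s w) = cnj c * herm u w"
  by (simp add: herm_def sum_distrib_left mult_ac)

lemma herm_minus_left: "herm (- u) w = - herm u w"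
  by (simp add: herm_def sum_negf)

lemma herm_minus_right: "herm u (- w) = - herm u w"
  by (simp add: herm_def sum_negf)

lemma herm_diff_left: "herm (u - v) w = herm u w - herm v w"
  using herm_add_left[of u "- v" w] by (simp add: herm_minus_left)

lemma herm_diff_right: "herm w (u - v) = herm w u - herm w v"
  using herm_add_right[of w u "- v"] by (simp add: herm_minus_right)

lemma herm_zero_left [simp]: "herm 0 w = 0" and herm_zero_right [simp]: "herm u 0 = 0"
  by (simp_all add: herm_def)

lemma herm_commute: "herm w u = cnj (herm u w)"
  by (simp add: herm_def mult.commute)

lemma herm_eq_0_commute: "herm u w = 0 \<longleftrightarrow> herm w u = 0"
  by (subst herm_commute) simp

lemma herm_eq_0_sym: "herm u w = 0 \<Longrightarrow> herm w u = 0"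
  by (simp add: herm_eq_0_commute[of w u])

lemma herm_self: "herm u u = of_real ((norm u)\<^sup>2)"
proof (rule complex_eqI)
  show "Re (herm u u) = Re (of_real ((norm u)\<^sup>2))"
    by (simp add: inner_eq_Re_herm[symmetric] power2_norm_eq_inner)
  show "Im (herm u u) = Im (of_real ((norm u)\<^sup>2))"
    using arg_cong[OF herm_commute[of u u], of Im] by simp
qed

lemma herm_self_eq_0 [simp]: "herm u u = 0 \<longleftrightarrow> u = 0"
  by (simp add: herm_self)

lemma sum_UNIV_times_2:
  "(\<Sum>p\<in>(UNIV :: ('m::finite \<times> 2) set). f p) = (\<Sum>k\<in>UNIV. f (k, 1) + f (k, 2))"
proof -
  have "sum f ((UNIV :: 'm set) \<times> (UNIV :: 2 set)) = (\<Sum>k\<in>UNIV. \<Sum>i\<in>UNIV. f (k, i))"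
    by (simp add: sum.cartesian_product del: UNIV_Times_UNIV)
  then show ?thesis by (simp add: sum_2)
qed

text \<open>This is the complex symplectic form: the conjugations of j and of the second slot
  cancel, which makes it bilinear, and it is alternating.\<close>

lemma herm_jmul_right: "herm u (jmul w) = - herm w (jmul u)"
  by (simp add: herm_def jmul_def sum_UNIV_times_2 sum_negf[symmetric] algebra_simps)

lemma herm_jmul_self [simp]: "herm u (jmul u) = 0"
  using herm_jmul_right[of u u] by simp

lemma herm_jmul_left: "herm (jmul u) w = - cnj (herm u (jmul w))"
  by (metis herm_commute herm_jmul_right complex_cnj_minus)

lemma herm_jmul_jmul: "herm (jmul u) (jmul w) = cnj (herm u w)"
  by (simp add: herm_jmul_left jmul_jmul herm_minus_right)

lemma norm_jmul: "norm (jmul u) = norm u"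
proof -
  have "(norm (jmul u))\<^sup>2 = (norm u)\<^sup>2"
    using herm_jmul_jmul[of u u] unfolding herm_self
    by (metis complex_cnj_complex_of_real of_real_eq_iff)
  then show ?thesis by simp
qed

lemma jmul_eq_0 [simp]: "jmul u = 0 \<longleftrightarrow> u = 0"
  by (metis norm_eq_zero norm_jmul)

lemma jmul_add: "jmul (u + w) = jmul u + jmul w"
  by (simp add: jmul_def vec_eq_iff)

lemma jmul_scale: "jmul (c *s u) = cnj c *s jmul u"
  by (simp add: jmul_def vec_eq_iff)

lemma jmul_minus: "jmul (- u) = - jmul u"
  by (simp add: jmul_def vec_eq_iff)

lemma jmul_diff: "jmul (u - w) = jmul u - jmul w"
  by (simp add: jmul_def vec_eq_iff)

lemma scaleR_eq_vec_scale: "r *\<^sub>R (u :: 'm::finite hvec) = complex_of_real r *s u"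
  by (simp add: vec_eq_iff scaleR_conv_of_real[where 'a=complex])

lemma bounded_linear_jmul: "bounded_linear (jmul :: 'm::finite hvec \<Rightarrow> 'm hvec)"
  unfolding linear_conv_bounded_linear[symmetric]
  by (rule linearI) (simp_all add: jmul_add scaleR_eq_vec_scale jmul_scale)

lemma bounded_bilinear_herm: "bounded_bilinear (herm :: 'm::finite hvec \<Rightarrow> 'm hvec \<Rightarrow> complex)"
  unfolding bilinear_conv_bounded_bilinear[symmetric] bilinear_def
  by (auto intro!: linearI simp: herm_add_left herm_add_right scaleR_eq_vec_scale
      herm_scale_left herm_scale_right scaleR_conv_of_real)

lemma bounded_bilinear_vec_scale:
  "bounded_bilinear ((*s) :: complex \<Rightarrow> 'm::finite hvec \<Rightarrow> 'm hvec)"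
  unfolding bilinear_conv_bounded_bilinear[symmetric] bilinear_def
  by (auto intro!: linearI simp: vec.scale_left_distrib vec.scale_right_distrib
      scaleR_eq_vec_scale scaleR_conv_of_real)

lemmas smooth_intros =
  smooth_on_const smooth_on_add smooth_on_minus smooth_on_diff smooth_on_mult smooth_on_divide
  smooth_on_bilinear[OF bounded_bilinear_herm] smooth_on_bilinear[OF bounded_bilinear_vec_scale]
  smooth_on_linear[OF bounded_linear_jmul] smooth_on_linear[OF bounded_linear_cnj] smooth_on_dd

text \<open>The Wirtinger operators \<open>(\<partial>\<^sub>x - e \<i> \<partial>\<^sub>y) / 2\<close> on vector-valued and scalar functions: \<open>e = 1\<close> is
  the derivative in z, \<open>e = -1\<close> the one in \<open>cnj z\<close>. Carrying the sign as a parameter makes every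
  statement available for both directions of the harmonic sequence.\<close>

definition wd :: "real \<Rightarrow> (complex \<Rightarrow> 'm::finite hvec) \<Rightarrow> complex \<Rightarrow> 'm hvec" where
  "wd e u z = (1/2) *s (dd u z 1 - (of_real e * \<i>) *s dd u z \<i>)"

definition wc :: "real \<Rightarrow> (complex \<Rightarrow> complex) \<Rightarrow> complex \<Rightarrow> complex" where
  "wc e g z = (1/2) * (dd g z 1 - (of_real e * \<i>) * dd g z \<i>)"

lemma dz_eq_wd: "dz = wd 1"
  by (simp add: dz_def wd_def fun_eq_iff)

lemma Basis_complex_mem [simp]: "1 \<in> (Basis :: complex set)" "\<i> \<in> (Basis :: complex set)"
  by (auto simp: Basis_complex_def)

lemma smooth_on_wd: "open U \<Longrightarrow> smooth_on U u \<Longrightarrow> smooth_on U (wd e u)"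
  unfolding wd_def by (intro smooth_intros) auto

lemma smooth_on_wc: "open U \<Longrightarrow> smooth_on U g \<Longrightarrow> smooth_on U (wc e g)"
  unfolding wc_def by (intro smooth_intros) auto

lemma wd_cong_open: "open U \<Longrightarrow> z \<in> U \<Longrightarrow> (\<And>x. x \<in> U \<Longrightarrow> f x = g x) \<Longrightarrow> wd e f z = wd e g z"
  unfolding wd_def using dd_cong_open[of U z f g] by simp

lemma wc_cong_open: "open U \<Longrightarrow> z \<in> U \<Longrightarrow> (\<And>x. x \<in> U \<Longrightarrow> f x = g x) \<Longrightarrow> wc e f z = wc e g z"
  unfolding wc_def using dd_cong_open[of U z f g] by simp

lemma wd_const [simp]: "wd e (\<lambda>x. c) z = 0"
  by (simp add: wd_def)

lemma wc_const [simp]: "wc e (\<lambda>x. c) z = 0"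
  by (simp add: wc_def)

lemma wd_zero_on: "open U \<Longrightarrow> z \<in> U \<Longrightarrow> (\<And>x. x \<in> U \<Longrightarrow> f x = 0) \<Longrightarrow> wd e f z = 0"
  using wd_cong_open[of U z f "\<lambda>x. 0"] by simp

lemma wc_zero_on: "open U \<Longrightarrow> z \<in> U \<Longrightarrow> (\<And>x. x \<in> U \<Longrightarrow> f x = 0) \<Longrightarrow> wc e f z = 0"
  using wc_cong_open[of U z f "\<lambda>x. 0"] by simp

section \<open>Product rules for the Wirtinger operators\<close>

context
  fixes U :: "complex set" and z :: complex
  assumes z: "z \<in> U"
begin

lemma dd_add_on: "smooth_on U f \<Longrightarrow> smooth_on U g \<Longrightarrow> dd (\<lambda>x. f x + g x) z X = dd f z X + dd g z X"
  by (rule dd_eqI, rule has_derivative_add) (use smooth_on_has_derivative z in blast)+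

lemma dd_linear_on: "bounded_linear L \<Longrightarrow> smooth_on U f \<Longrightarrow> dd (\<lambda>x. L (f x)) z X = L (dd f z X)"
  by (rule dd_eqI, rule bounded_linear.has_derivative) (use smooth_on_has_derivative z in blast)+

lemma dd_bilinear_on:
  "bounded_bilinear B \<Longrightarrow> smooth_on U f \<Longrightarrow> smooth_on U g \<Longrightarrow>
    dd (\<lambda>x. B (f x) (g x)) z X = B (f z) (dd g z X) + B (dd f z X) (g z)"
  by (rule dd_eqI, rule bounded_bilinear.FDERIV) (use smooth_on_has_derivative z in blast)+

lemma wd_add: "smooth_on U u \<Longrightarrow> smooth_on U w \<Longrightarrow> wd e (\<lambda>x. u x + w x) z = wd e u z + wd e w z"
  by (simp add: wd_def dd_add_on vec_eq_iff algebra_simps)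

lemma wd_scale:
  "smooth_on U g \<Longrightarrow> smooth_on U u \<Longrightarrow> wd e (\<lambda>x. g x *s u x) z = g z *s wd e u z + wc e g z *s u z"
  by (simp add: wd_def wc_def dd_bilinear_on[OF bounded_bilinear_vec_scale] vec_eq_iff algebra_simps)

lemma wc_mult:
  "smooth_on U f \<Longrightarrow> smooth_on U g \<Longrightarrow> wc e (\<lambda>x. f x * g x) z = f z * wc e g z + wc e f z * g z"
  by (simp add: wc_def dd_bilinear_on[OF bounded_bilinear_mult] algebra_simps)

lemma wd_minus: "smooth_on U u \<Longrightarrow> wd e (\<lambda>x. - u x) z = - wd e u z"
  by (simp add: wd_def dd_linear_on[OF bounded_linear_minus[OF bounded_linear_ident]]
      vec_eq_iff algebra_simps)

lemma wd_diff: 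
  assumes "open U" "smooth_on U u" "smooth_on U w"
  shows "wd e (\<lambda>x. u x - w x) z = wd e u z - wd e w z"
  using wd_add[OF assms(2) smooth_on_minus[OF assms(1,3)]] assms by (simp add: wd_minus)

text \<open>Conjugate linearity of the second slot turns the operator of sign e into the one of sign
  - e. The same happens for j in \<open>wd_jmul\<close>.\<close>

lemma wc_herm:
  "smooth_on U u \<Longrightarrow> smooth_on U w \<Longrightarrow>
    wc e (\<lambda>x. herm (u x) (w x)) z = herm (wd e u z) (w z) + herm (u z) (wd (- e) w z)"
  by (simp add: wc_def wd_def dd_bilinear_on[OF bounded_bilinear_herm] herm_add_left herm_add_right
      herm_scale_left herm_scale_right herm_diff_left herm_diff_right algebra_simps)

lemma wd_jmul: "smooth_on U u \<Longrightarrow> wd e (\<lambda>x. jmul (u x)) z = jmul (wd (- e) u z)"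
  by (simp add: wd_def dd_linear_on[OF bounded_linear_jmul] jmul_scale jmul_diff jmul_add jmul_minus)

lemma wc_cnj: "smooth_on U g \<Longrightarrow> wc e (\<lambda>x. cnj (g x)) z = cnj (wc (- e) g z)"
  by (simp add: wc_def dd_linear_on[OF bounded_linear_cnj])

end

text \<open>As the mixed derivatives agree, e and f enter only through their sum and product, which
  gives commutation. For e = 1 or -1 and f = - e the result is a quarter of the Laplacian.\<close>

lemma wd_wd:
  assumes "open U" "z \<in> U" "smooth_on U u"
  shows "wd e (wd f u) z = (1/4) *s (dd (\<lambda>p. dd u p 1) z 1
    - (of_real (e + f) * \<i>) *s dd (\<lambda>p. dd u p 1) z \<i> - of_real (e * f) *s dd (\<lambda>p. dd u p \<i>) z \<i>)"
proof -
  note mp = mixed_partials[OF assms Basis_complex_mem]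
  have s: "smooth_on U (\<lambda>x. dd u x 1)" "smooth_on U (\<lambda>x. dd u x \<i>)"
    using assms by (auto intro: smooth_intros)
  have D: "dd (wd f u) z X = (1/2) *s (dd (\<lambda>p. dd u p 1) z X - (of_real f * \<i>) *s dd (\<lambda>p. dd u p \<i>) z X)" for X
  proof -
    have lin: "bounded_linear (\<lambda>w. c *s w :: 'a hvec)" for c
      using bounded_bilinear.bounded_linear_right[OF bounded_bilinear_vec_scale] .
    have eq: "wd f u = (\<lambda>p. (1/2) *s (dd u p 1 + (- (of_real f * \<i>)) *s dd u p \<i>))"
      by (auto simp: wd_def fun_eq_iff vec_eq_iff)
    have "dd (\<lambda>p. (1/2) *s (dd u p 1 + c *s dd u p \<i>)) z X
        = (1/2) *s (dd (\<lambda>p. dd u p 1) z X + c *s dd (\<lambda>p. dd u p \<i>) z X)" for c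
      using s smooth_on_linear[OF lin assms(1)] smooth_on_add[OF assms(1)]
      by (simp add: dd_linear_on[OF assms(2) lin] dd_add_on[OF assms(2)])
    from this[of "- (of_real f * \<i>)"] show ?thesis unfolding eq by (simp add: vec_eq_iff)
  qed
  show ?thesis
    unfolding wd_def[of e "wd f u"] D mp by (simp add: vec_eq_iff algebra_simps)
qed

lemma wd_commute:
  assumes "open U" "z \<in> U" "smooth_on U u"
  shows "wd e (wd f u) z = wd f (wd e u) z"
  by (simp add: wd_wd[OF assms] add.commute mult.commute)

lemma wc_commute:
  assumes "open U" "z \<in> U" "smooth_on U g"
  shows "wc e (wc f g) z = wc f (wc e g) z"
proof -
  note mp = mixed_partials[OF assms Basis_complex_mem]
  have s: "smooth_on U (\<lambda>x. dd g x 1)" "smooth_on U (\<lambda>x. dd g x \<i>)"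
    using assms by (auto intro: smooth_intros)
  have D: "dd (wc f g) z X = (1/2) * (dd (\<lambda>p. dd g p 1) z X - (of_real f * \<i>) * dd (\<lambda>p. dd g p \<i>) z X)" for f X
  proof -
    have lin: "bounded_linear (\<lambda>w. c * w :: complex)" for c
      using bounded_linear_mult_right .
    have eq: "wc f g = (\<lambda>p. (1/2) * (dd g p 1 + (- (of_real f * \<i>)) * dd g p \<i>))"
      by (auto simp: wc_def fun_eq_iff)
    have "dd (\<lambda>p. (1/2) * (dd g p 1 + c * dd g p \<i>)) z X
        = (1/2) * (dd (\<lambda>p. dd g p 1) z X + c * dd (\<lambda>p. dd g p \<i>) z X)" for c
    proof -
      have s3: "smooth_on U (\<lambda>p. c * dd g p \<i>)"
        by (rule smooth_on_linear[OF lin assms(1) s(2)])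
      show ?thesis
        unfolding dd_linear_on[OF assms(2) lin smooth_on_add[OF assms(1) s(1) s3]]
          dd_add_on[OF assms(2) s(1) s3] dd_linear_on[OF assms(2) lin s(2)] ..
    qed
    from this[of "- (of_real f * \<i>)"] show ?thesis unfolding eq by simp
  qed
  show ?thesis
    unfolding wc_def[of _ "wc _ _"] D mp by (simp add: algebra_simps)
qed

text \<open>The last hypothesis is the Cauchy-Riemann equation, which makes the real derivative
  complex linear.\<close>

lemma wc_zero_imp_holomorphic:
  assumes "open M" "smooth_on M g" "\<And>z. z \<in> M \<Longrightarrow> wc (-1) g z = 0"
  shows "g holomorphic_on M"
  unfolding holomorphic_on_open[OF assms(1)]
proof
  fix z assume z: "z \<in> M"
  have d: "(g has_derivative dd g z) (at z)" by (rule smooth_on_has_derivative[OF assms(2) z])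
  then have lin: "linear (dd g z)" by (rule has_derivative_linear)
  from assms(3)[OF z] have "dd g z 1 = - (\<i> * dd g z \<i>)"
    by (simp add: wc_def add_eq_0_iff)
  then have i: "dd g z \<i> = \<i> * dd g z 1"
    by simp
  have eq: "dd g z X = dd g z 1 * X" for X
  proof -
    have X: "X = Re X *\<^sub>R 1 + Im X *\<^sub>R \<i>" by (simp add: complex_eq_iff)
    have "dd g z (Re X *\<^sub>R 1 + Im X *\<^sub>R \<i>) = Re X *\<^sub>R dd g z 1 + Im X *\<^sub>R dd g z \<i>"
      by (simp only: linear_add[OF lin] linear_scale[OF lin])
    also have "\<dots> = dd g z 1 * (Re X *\<^sub>R 1 + Im X *\<^sub>R \<i>)"
      unfolding i by (simp add: scaleR_conv_of_real algebra_simps)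
    finally show ?thesis by (simp only: X[symmetric])
  qed
  have "(g has_field_derivative dd g z 1) (at z)"
    by (rule has_derivative_imp_has_field_derivative[OF d trans[OF mult.commute eq[symmetric]]])
  then show "\<exists>f'. (g has_field_derivative f') (at z)" ..
qed

text \<open>For e = 1 the function g is holomorphic, for e = -1 its conjugate is; either way
  analytic continuation applies.\<close>

lemma wirtinger_identity_theorem:
  assumes M: "open M" "connected M" and e: "\<bar>e\<bar> = 1"
    and g: "smooth_on M g" "\<And>z. z \<in> M \<Longrightarrow> wc (- e) g z = 0"
    and V: "open V" "V \<noteq> {}" "V \<subseteq> M" "\<And>z. z \<in> V \<Longrightarrow> g z = 0"
    and z: "z \<in> M"
  shows "g z = 0"
proof -
  have main: "f z = 0" if "f holomorphic_on M" "\<And>w. w \<in> V \<Longrightarrow> f w = 0" for f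
    using analytic_continuation_open[of V M f "\<lambda>_. 0" z] that M V z by auto
  consider "e = 1" | "e = -1" using e by linarith
  then show ?thesis
  proof cases
    case 1
    then show ?thesis using main[OF wc_zero_imp_holomorphic[OF M(1) g(1)]] g(2) V(4) by simp
  next
    case 2
    have "(\<lambda>z. cnj (g z)) holomorphic_on M"
      using g 2 by (intro wc_zero_imp_holomorphic M smooth_intros) (auto simp: wc_cnj[OF _ g(1)])
    then show ?thesis using main[of "\<lambda>z. cnj (g z)"] V(4) by simp
  qed
qed

subsection \<open>Bundles with orthogonal frames\<close>

text \<open>The vectors may be zero: with \<open>cspan2 a 0\<close> for the line of a, line bundles,
  rank two bundles and degenerate ones share all lemmas.\<close>

definition cspan2 :: "'m::finite hvec \<Rightarrow> 'm hvec \<Rightarrow> 'm hvec set" where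
  "cspan2 a b = {\<alpha> *s a + \<beta> *s b | \<alpha> \<beta>. True}"

lemma cspan2_iff: "x \<in> cspan2 a b \<longleftrightarrow> (\<exists>\<alpha> \<beta>. x = \<alpha> *s a + \<beta> *s b)"
  by (simp add: cspan2_def)

lemma hp_point_eq_cspan2: "hp_point q = cspan2 q (jmul q)"
  by (simp add: hp_point_def cspan2_def)

lemma cp_point_eq_cspan2: "cp_point q = cspan2 q 0"
  by (simp add: cp_point_def cspan2_def)

lemma herm_cspan2_right: "herm u a = 0 \<Longrightarrow> herm u b = 0 \<Longrightarrow> x \<in> cspan2 a b \<Longrightarrow> herm u x = 0"
  by (auto simp: cspan2_iff herm_add_right herm_scale_right)

lemma mem_cspan2: "a \<in> cspan2 a b" "b \<in> cspan2 a b"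
  unfolding cspan2_iff
  by (rule exI[of _ 1], rule exI[of _ 0], simp) (rule exI[of _ 0], rule exI[of _ 1], simp)

text \<open>By \<open>x / 0 = 0\<close> the projection is zero when a = 0.\<close>

definition lproj :: "'m::finite hvec \<Rightarrow> 'm hvec \<Rightarrow> 'm hvec" where
  "lproj a u = (herm u a / herm a a) *s a"

text \<open>This is the projection off \<open>cspan2 a b\<close> only for orthogonal a and b, the
  standing assumption of the context below.\<close>

definition perp2 :: "'m::finite hvec \<Rightarrow> 'm hvec \<Rightarrow> 'm hvec \<Rightarrow> 'm hvec" where
  "perp2 a b u = u - lproj a u - lproj b u"

lemma lproj_eq_0: "herm u a = 0 \<Longrightarrow> lproj a u = 0"
  by (simp add: lproj_def)

lemma lproj_zero [simp]: "lproj 0 u = 0"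
  by (simp add: lproj_def)

lemma lproj_self: "lproj a a = a"
  by (cases "a = 0") (auto simp: lproj_def)

lemma lproj_add: "lproj a (u + w) = lproj a u + lproj a w"
  by (simp add: lproj_def herm_add_left add_divide_distrib vec.scale_left_distrib)

lemma lproj_scale: "lproj a (c *s u) = c *s lproj a u"
  by (simp add: lproj_def herm_scale_left vec_eq_iff)

lemma perp2_add: "perp2 a b (u + w) = perp2 a b u + perp2 a b w"
  by (simp add: perp2_def lproj_add)

lemma perp2_scale: "perp2 a b (c *s u) = c *s perp2 a b u"
  by (simp add: perp2_def lproj_scale vec_eq_iff algebra_simps)

context
  fixes a b :: "'m::finite hvec"
  assumes ab: "herm a b = 0"
begin

lemma herm_ba: "herm b a = 0"
  using ab herm_eq_0_commute by blast

lemma perp2_left: "perp2 a b a = 0"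
  by (simp add: perp2_def lproj_self lproj_eq_0 ab)

lemma perp2_right: "perp2 a b b = 0"
  by (simp add: perp2_def lproj_self lproj_eq_0 herm_ba)

lemma herm_perp2: "herm (perp2 a b u) a = 0" "herm (perp2 a b u) b = 0"
proof -
  have *: "herm u x / herm x x * herm x x = herm u x" for x by (cases "x = 0") auto
  show "herm (perp2 a b u) a = 0" "herm (perp2 a b u) b = 0"
    by (simp_all only: perp2_def lproj_def herm_diff_left herm_scale_left ab herm_ba *) simp_all
qed

text \<open>Pythagoras: the projection of u minus x lies in the span, hence is orthogonal to
  \<open>perp2 a b u\<close>. Both the closest point and the distance to the span follow.\<close>

lemma norm_perp2_le:
  assumes x: "x \<in> cspan2 a b"
  shows "norm (perp2 a b u) \<le> dist u x"
proof -
  obtain \<alpha> \<beta> where x: "x = \<alpha> *s a + \<beta> *s b" using x by (auto simp: cspan2_iff)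
  define p where "p = lproj a u + lproj b u - x"
  have p: "p = (herm u a / herm a a - \<alpha>) *s a + (herm u b / herm b b - \<beta>) *s b"
    by (simp add: p_def x lproj_def vec_eq_iff algebra_simps)
  have "herm (perp2 a b u) p = 0"
    unfolding p herm_add_right herm_scale_right herm_perp2 by simp
  then have "perp2 a b u \<bullet> p = 0" by (simp add: inner_eq_Re_herm)
  then have "(norm (perp2 a b u + p))\<^sup>2 = (norm (perp2 a b u))\<^sup>2 + (norm p)\<^sup>2"
    by (simp add: power2_norm_eq_inner inner_add_left inner_add_right inner_commute)
  moreover have "perp2 a b u + p = u - x" by (simp add: perp2_def p_def)
  ultimately have "(norm (perp2 a b u))\<^sup>2 \<le> (norm (u - x))\<^sup>2" by simp
  then show ?thesis by (simp add: dist_norm power2_le_iff_abs_le)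
qed

lemma cspan2_proj: "u - perp2 a b u \<in> cspan2 a b"
  unfolding perp2_def lproj_def cspan2_iff
  by (intro exI[of _ "herm u a / herm a a"] exI[of _ "herm u b / herm b b"]) simp

lemma subspace_cspan2: "subspace (cspan2 a b)"
proof (rule subspaceI)
  show "0 \<in> cspan2 a b" unfolding cspan2_iff by (intro exI[of _ 0]) simp
next
  fix x y assume "x \<in> cspan2 a b" "y \<in> cspan2 a b"
  then obtain \<alpha> \<beta> \<gamma> \<delta> where "x = \<alpha> *s a + \<beta> *s b" "y = \<gamma> *s a + \<delta> *s b"
    by (auto simp: cspan2_iff)
  then show "x + y \<in> cspan2 a b" unfolding cspan2_iff
    by (intro exI[of _ "\<alpha> + \<gamma>"] exI[of _ "\<beta> + \<delta>"]) (simp add: vec_eq_iff algebra_simps)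
next
  fix c x assume "x \<in> cspan2 a b"
  then obtain \<alpha> \<beta> where "x = \<alpha> *s a + \<beta> *s b" by (auto simp: cspan2_iff)
  then show "c *\<^sub>R x \<in> cspan2 a b" unfolding cspan2_iff scaleR_eq_vec_scale
    by (intro exI[of _ "of_real c * \<alpha>"] exI[of _ "of_real c * \<beta>"]) (simp add: vec_eq_iff algebra_simps)
qed

lemma proj_perp_cspan2: "proj_perp (cspan2 a b) u = perp2 a b u"
proof -
  have "u - perp2 a b u = closest_point (cspan2 a b) u"
    using norm_perp2_le[of _ u] cspan2_proj[of u] subspace_cspan2
    by (intro closest_point_unique) (auto simp: closed_subspace subspace_imp_convex dist_norm)
  then show ?thesis unfolding proj_perp_def by (simp add: \<open>u - perp2 a b u = closest_point (cspan2 a b) u\<close>[symmetric])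
qed

lemma infdist_cspan2: "infdist u (cspan2 a b) = norm (perp2 a b u)"
proof (rule antisym)
  have "infdist u (cspan2 a b) \<le> dist u (u - perp2 a b u)" by (rule infdist_le[OF cspan2_proj])
  then show "infdist u (cspan2 a b) \<le> norm (perp2 a b u)" by (simp add: dist_norm)
  show "norm (perp2 a b u) \<le> infdist u (cspan2 a b)"
    using cspan2_proj[of u] norm_perp2_le[of _ u]
    by (auto simp: infdist_def intro!: cINF_greatest)
qed

end

text \<open>On such a set the junk value \<open>x / 0 = 0\<close> is taken everywhere or nowhere, so that normalised
  coefficients along f are smooth.\<close>

definition zero_or_nonvanishing :: "complex set \<Rightarrow> (complex \<Rightarrow> 'm::finite hvec) \<Rightarrow> bool" where
  "zero_or_nonvanishing U f \<longleftrightarrow> (\<forall>x\<in>U. f x = 0) \<or> (\<forall>x\<in>U. f x \<noteq> 0)"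

lemma zero_or_nonvanishing_subset: "zero_or_nonvanishing U f \<Longrightarrow> V \<subseteq> U \<Longrightarrow> zero_or_nonvanishing V f"
  unfolding zero_or_nonvanishing_def by blast

lemma smooth_on_herm_quotient:
  assumes "open U" "smooth_on U u" "smooth_on U f" "zero_or_nonvanishing U f"
  shows "smooth_on U (\<lambda>x. herm (u x) (f x) / herm (f x) (f x))"
proof -
  consider "\<forall>x\<in>U. f x = 0" | "\<forall>x\<in>U. f x \<noteq> 0" using assms(4) zero_or_nonvanishing_def by blast
  then show ?thesis
  proof cases
    case 1
    then show ?thesis
      by (subst smooth_on_cong[OF assms(1), of _ "\<lambda>_. 0"]) (auto intro: smooth_on_const)
  next
    case 2
    then show ?thesis by (intro smooth_intros assms) auto
  qed
qed

lemma smooth_on_lproj: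
  assumes "open U" "smooth_on U u" "smooth_on U f" "zero_or_nonvanishing U f"
  shows "smooth_on U (\<lambda>x. lproj (f x) (u x))"
  unfolding lproj_def by (intro smooth_intros smooth_on_herm_quotient assms)

text \<open>A section of the frame may vanish identically, so that degenerate bundles are included;
  otherwise it has no zero, which keeps coefficients smooth.\<close>

definition frame2 :: "complex set \<Rightarrow> (complex \<Rightarrow> 'm::finite hvec) \<Rightarrow> (complex \<Rightarrow> 'm hvec) \<Rightarrow> bool" where
  "frame2 U e1 e2 \<longleftrightarrow> open U \<and> smooth_on U e1 \<and> smooth_on U e2 \<and> (\<forall>x\<in>U. herm (e1 x) (e2 x) = 0) \<and>
     zero_or_nonvanishing U e1 \<and> zero_or_nonvanishing U e2"

text \<open>Terms with differentiated coefficients lie in the bundle and are projected away, so only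
  derivatives of the frame matter. Conversely, sections with constant coefficients reach every
  combination.\<close>

lemma A'_image_frame2:
  assumes f: "frame2 U e1 e2" and psi: "\<And>x. x \<in> U \<Longrightarrow> \<psi> x = cspan2 (e1 x) (e2 x)" and w: "w \<in> U"
  shows "A'_image \<psi> w = cspan2 (perp2 (e1 w) (e2 w) (wd 1 e1 w)) (perp2 (e1 w) (e2 w) (wd 1 e2 w))"
proof -
  note fr = f[unfolded frame2_def]
  have orth: "herm (e1 x) (e2 x) = 0" if "x \<in> U" for x using fr that by blast
  show ?thesis
  proof (intro set_eqI iffI)
    fix y assume "y \<in> A'_image \<psi> w"
    then obtain v V where V: "w \<in> V" "local_section V \<psi> v" and y: "y = proj_perp (\<psi> w) (dz v w)"
      unfolding A'_image_def by blast
    define W where "W = U \<inter> V"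
    have W: "open W" "w \<in> W" "W \<subseteq> U" "W \<subseteq> V" using V w fr by (auto simp: W_def local_section_def)
    define \<alpha> where "\<alpha> = (\<lambda>x. herm (v x) (e1 x) / herm (e1 x) (e1 x))"
    define \<beta> where "\<beta> = (\<lambda>x. herm (v x) (e2 x) / herm (e2 x) (e2 x))"
    have sm: "smooth_on W v" "smooth_on W e1" "smooth_on W e2"
      using fr V W unfolding local_section_def by (blast intro: smooth_on_subset)+
    have ab: "smooth_on W \<alpha>" "smooth_on W \<beta>" unfolding \<alpha>_def \<beta>_def
      using fr zero_or_nonvanishing_subset[OF _ W(3)]
      by (auto intro!: smooth_on_herm_quotient sm W(1))
    have v: "v x = \<alpha> x *s e1 x + \<beta> x *s e2 x" if "x \<in> W" for x
    proof -
      have x: "x \<in> U" "v x \<in> cspan2 (e1 x) (e2 x)"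
        using V that W psi unfolding local_section_def by blast+
      then obtain c d where "v x = c *s e1 x + d *s e2 x" by (auto simp: cspan2_iff)
      then have "perp2 (e1 x) (e2 x) (v x) = 0"
        by (simp add: perp2_add perp2_scale perp2_left perp2_right orth[OF x(1)])
      then show ?thesis by (simp add: perp2_def lproj_def \<alpha>_def \<beta>_def algebra_simps)
    qed
    have "dz v w = wd 1 (\<lambda>x. \<alpha> x *s e1 x + \<beta> x *s e2 x) w"
      unfolding dz_eq_wd by (rule wd_cong_open[OF W(1,2)]) (rule v)
    also have "\<dots> = (\<alpha> w *s wd 1 e1 w + wc 1 \<alpha> w *s e1 w) + (\<beta> w *s wd 1 e2 w + wc 1 \<beta> w *s e2 w)"
      using ab sm W(1)
      by (simp add: wd_add[OF W(2)] wd_scale[OF W(2)] smooth_intros)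
    finally have "perp2 (e1 w) (e2 w) (dz v w)
      = \<alpha> w *s perp2 (e1 w) (e2 w) (wd 1 e1 w) + \<beta> w *s perp2 (e1 w) (e2 w) (wd 1 e2 w)"
      by (simp add: perp2_add perp2_scale perp2_left perp2_right orth[OF w])
    moreover have "y = perp2 (e1 w) (e2 w) (dz v w)"
      using y psi[OF w] proj_perp_cspan2[OF orth[OF w]] by simp
    ultimately show "y \<in> cspan2 (perp2 (e1 w) (e2 w) (wd 1 e1 w)) (perp2 (e1 w) (e2 w) (wd 1 e2 w))"
      unfolding cspan2_iff by blast
  next
    fix y assume "y \<in> cspan2 (perp2 (e1 w) (e2 w) (wd 1 e1 w)) (perp2 (e1 w) (e2 w) (wd 1 e2 w))"
    then obtain \<alpha> \<beta> where y: "y = \<alpha> *s perp2 (e1 w) (e2 w) (wd 1 e1 w) + \<beta> *s perp2 (e1 w) (e2 w) (wd 1 e2 w)"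
      unfolding cspan2_iff by blast
    define v where "v = (\<lambda>x. \<alpha> *s e1 x + \<beta> *s e2 x)"
    have sm: "smooth_on U (\<lambda>x. \<alpha> *s e1 x)" "smooth_on U (\<lambda>x. \<beta> *s e2 x)"
      using fr by (auto intro!: smooth_intros)
    have "local_section U \<psi> v"
      using fr sm by (auto simp: local_section_def v_def psi cspan2_iff intro!: smooth_on_add)
    moreover have "dz v w = \<alpha> *s wd 1 e1 w + \<beta> *s wd 1 e2 w"
      unfolding dz_eq_wd v_def wd_add[OF w sm]
      using wd_scale[OF w smooth_on_const, of e1 1 \<alpha>] wd_scale[OF w smooth_on_const, of e2 1 \<beta>] fr
      by simp
    then have "y = proj_perp (\<psi> w) (dz v w)"
      by (simp add: y psi[OF w] proj_perp_cspan2[OF orth[OF w]] perp2_add perp2_scale)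
    ultimately show "y \<in> A'_image \<psi> w" unfolding A'_image_def using w by blast
  qed
qed

text \<open>Over a frame the distance to the image is the norm of \<open>perp2\<close>, which is
  continuous at z; its limit is therefore its value there.\<close>

lemma next_bundle_frame2:
  assumes f: "frame2 U e1 e2" and psi: "\<And>x. x \<in> U \<Longrightarrow> A'_image \<psi> x = cspan2 (e1 x) (e2 x)" and z: "z \<in> U"
  shows "next_bundle \<psi> z = cspan2 (e1 z) (e2 z)"
proof -
  note fr = f[unfolded frame2_def]
  have orth: "herm (e1 x) (e2 x) = 0" if "x \<in> U" for x using fr that by blast
  have lim: "((\<lambda>w. infdist v (A'_image \<psi> w)) \<longlongrightarrow> norm (perp2 (e1 z) (e2 z) v)) (at z)" for v
  proof -
    have "smooth_on U (\<lambda>w. perp2 (e1 w) (e2 w) v)"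
      unfolding perp2_def using fr by (intro smooth_intros smooth_on_lproj) auto
    then have "continuous_on U (\<lambda>w. norm (perp2 (e1 w) (e2 w) v))"
      by (intro continuous_on_norm smooth_on_imp_continuous_on)
    then have "((\<lambda>w. norm (perp2 (e1 w) (e2 w) v)) \<longlongrightarrow> norm (perp2 (e1 z) (e2 z) v)) (at z)"
      using fr z by (simp add: continuous_on_eq_continuous_at isCont_def)
    moreover have "\<forall>\<^sub>F w in at z. norm (perp2 (e1 w) (e2 w) v) = infdist v (A'_image \<psi> w)"
      unfolding eventually_at_topological using fr z
      by (intro exI[of _ U]) (auto simp: psi infdist_cspan2[OF orth])
    ultimately show ?thesis by (rule Lim_transform_eventually)
  qed
  have "v \<in> next_bundle \<psi> z \<longleftrightarrow> perp2 (e1 z) (e2 z) v = 0" for v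
    unfolding next_bundle_def
    using lim[of v] LIM_unique[OF lim[of v]] by fastforce
  moreover have "perp2 (e1 z) (e2 z) v = 0 \<longleftrightarrow> v \<in> cspan2 (e1 z) (e2 z)" for v
  proof
    assume "perp2 (e1 z) (e2 z) v = 0"
    then show "v \<in> cspan2 (e1 z) (e2 z)" using cspan2_proj[OF orth[OF z], of v] by simp
  next
    assume "v \<in> cspan2 (e1 z) (e2 z)"
    then show "perp2 (e1 z) (e2 z) v = 0"
      by (auto simp: cspan2_iff perp2_add perp2_scale perp2_left perp2_right orth[OF z])
  qed
  ultimately show ?thesis by blast
qed

text \<open>This serves at zeros of the sections, where no frame is at hand. Perpendicularity at a
  dense set of points suffices: x is close to a vector perpendicular to \<open>s w\<close>, and
  \<open>s w\<close> is close to \<open>s z\<close>.\<close>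

lemma next_bundle_perp:
  assumes M: "open M" "z \<in> M" and s: "continuous_on M s" "\<And>w. w \<in> M \<Longrightarrow> norm (s w) = 1"
    and dense: "\<And>V. open V \<Longrightarrow> V \<noteq> {} \<Longrightarrow> V \<subseteq> M \<Longrightarrow>
      \<exists>w\<in>V. A'_image \<psi> w \<noteq> {} \<and> (\<forall>y\<in>A'_image \<psi> w. herm (s w) y = 0)"
    and x: "x \<in> next_bundle \<psi> z"
  shows "herm (s z) x = 0"
proof (rule ccontr)
  assume nz: "herm (s z) x \<noteq> 0"
  obtain K where K: "K > 0" "\<And>u v :: 'a hvec. norm (herm u v) \<le> norm u * norm v * K"
    using bounded_bilinear.pos_bounded[OF bounded_bilinear_herm] by blast
  define d where "d = norm (herm (s z) x) / 2"
  have d: "d > 0" using nz by (simp add: d_def)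
  have "continuous_on M (\<lambda>w. herm (s w) x)"
    using s(1) by (intro bounded_bilinear.continuous_on[OF bounded_bilinear_herm]) auto
  then have "((\<lambda>w. norm (herm (s w) x)) \<longlongrightarrow> norm (herm (s z) x)) (at z)"
    using M by (auto simp: continuous_on_eq_continuous_at isCont_def intro: tendsto_norm)
  then have "\<forall>\<^sub>F w in at z. norm (herm (s w) x) > d"
    using nz by (intro order_tendstoD) (auto simp: d_def)
  moreover have "\<forall>\<^sub>F w in at z. infdist x (A'_image \<psi> w) < d / K"
    using x d K(1) unfolding next_bundle_def by (auto intro!: order_tendstoD)
  ultimately have "\<forall>\<^sub>F w in at z. norm (herm (s w) x) > d \<and> infdist x (A'_image \<psi> w) < d / K"
    by (rule eventually_conj)
  then obtain S where S: "open S" "z \<in> S"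
    "\<And>w. w \<in> S \<Longrightarrow> w \<noteq> z \<Longrightarrow> norm (herm (s w) x) > d \<and> infdist x (A'_image \<psi> w) < d / K"
    unfolding eventually_at_topological by blast
  \<comment> \<open>The limit ignores z itself, so z is removed; something is left because
    singletons are not open.\<close>
  define V where "V = (S \<inter> M) - {z}"
  have "open V" "V \<subseteq> M" unfolding V_def using S M by (auto simp: open_delete)
  moreover have "V \<noteq> {}"
  proof
    assume "V = {}"
    then have "S \<inter> M = {z}" using S M by (auto simp: V_def)
    then show False using open_Int[OF S(1) M(1)] not_open_singleton[of z] by simp
  qed
  ultimately obtain w where w: "w \<in> V" "A'_image \<psi> w \<noteq> {}" "\<forall>y\<in>A'_image \<psi> w. herm (s w) y = 0"
    using dense by blast
  have w': "norm (herm (s w) x) > d" "infdist x (A'_image \<psi> w) < d / K" "w \<in> M"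
    using S(3) w(1) by (auto simp: V_def)
  obtain y where y: "y \<in> A'_image \<psi> w" "dist x y < d / K"
    using w'(2) w(2) unfolding infdist_def by (auto simp: cINF_less_iff)
  have "herm (s w) x = herm (s w) (x - y)" using w(3) y(1) by (simp add: herm_diff_right)
  then have "norm (herm (s w) x) \<le> norm (x - y) * K"
    using K(2)[of "s w" "x - y"] s(2)[OF w'(3)] by simp
  also have "\<dots> < d" using y(2) K(1) by (simp add: dist_norm pos_less_divide_eq)
  finally show False using w'(1) by simp
qed

subsection \<open>Structure equations of the harmonic sequence of a lift\<close>

text \<open>The condition \<open>\<bar>e\<bar> = 1\<close> stands for e = 1 or e = -1. One function
  \<rho> serves both signs, so the two halves of the sequence start from the same data.\<close>

locale horizontal_harmonic_lift =
  fixes M :: "complex set" and s :: "complex \<Rightarrow> 'm::finite hvec" and \<rho> :: "complex \<Rightarrow> complex"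
  assumes open_M: "open M" and connected_M: "connected M"
    and smooth_s: "smooth_on M s"
    and unit_s: "z \<in> M \<Longrightarrow> herm (s z) (s z) = 1"
    and hor_s: "z \<in> M \<Longrightarrow> herm (wd e s z) (s z) = 0"
    and hor_js: "z \<in> M \<Longrightarrow> herm (wd e s z) (jmul (s z)) = 0"
    and harmonic_s: "\<bar>e\<bar> = 1 \<Longrightarrow> z \<in> M \<Longrightarrow> wd (- e) (wd e s) z = - (\<rho> z *s s z)"
begin

text \<open>For \<open>e = 1\<close> and \<open>e = -1\<close> these are the sections \<open>v\<^sub>k\<close> and \<open>v\<^sub>-\<^sub>k\<close>.\<close>

primrec v :: "real \<Rightarrow> nat \<Rightarrow> complex \<Rightarrow> 'm hvec" where
  "v e 0 = s"
| "v e (Suc k) = (\<lambda>z. wd e (v e k) z - lproj (v e k z) (wd e (v e k) z))"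

text \<open>The squared norm, kept complex so that \<open>wc\<close> applies to it.\<close>

definition N :: "real \<Rightarrow> nat \<Rightarrow> complex \<Rightarrow> complex" where
  "N e k z = herm (v e k z) (v e k z)"

definition \<mu> :: "real \<Rightarrow> nat \<Rightarrow> complex \<Rightarrow> complex" where
  "\<mu> e k z = herm (wd e (v e k) z) (v e k z) / herm (v e k z) (v e k z)"

text \<open>By \<open>x / 0 = 0\<close> this is zero where \<open>v e k\<close> vanishes.\<close>

definition \<gamma> :: "real \<Rightarrow> nat \<Rightarrow> complex \<Rightarrow> complex" where
  "\<gamma> e k z = N e (Suc k) z / N e k z"

text \<open>Both signs are controlled at once, because sections of opposite signs are compared and
  combined into frames.\<close>

definition regular :: "complex set \<Rightarrow> nat \<Rightarrow> bool" where
  "regular U k \<longleftrightarrow> open U \<and> U \<subseteq> M \<and> (\<forall>i\<le>k. \<forall>e. \<bar>e\<bar> = 1 \<longrightarrow> zero_or_nonvanishing U (v e i))"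

lemma v_Suc: "v e (Suc k) = (\<lambda>z. wd e (v e k) z - \<mu> e k z *s v e k z)"
  by (simp add: \<mu>_def lproj_def)

lemma wd_v: "wd e (v e k) z = v e (Suc k) z + \<mu> e k z *s v e k z"
  by (simp add: v_Suc del: v.simps)

lemma v_1: "z \<in> M \<Longrightarrow> v e (Suc 0) z = wd e s z"
  by (simp add: lproj_eq_0 hor_s)

lemma herm_v_Suc_v: "herm (v e (Suc k) z) (v e k z) = 0"
proof -
  have *: "herm u x / herm x x * herm x x = herm u x" for u x :: "'m hvec" by (cases "x = 0") auto
  show ?thesis by (simp add: lproj_def herm_diff_left herm_scale_left *)
qed

lemma regular_subset: "regular U k \<Longrightarrow> open V \<Longrightarrow> V \<subseteq> U \<Longrightarrow> regular V k"
  unfolding regular_def using zero_or_nonvanishing_subset by blast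

text \<open>The range reaches \<open>Suc k\<close> because forming \<open>v e (Suc k)\<close>
  divides only by the norm of \<open>v e k\<close>.\<close>

lemma smooth_v:
  assumes U: "regular U k" and e: "\<bar>e\<bar> = 1"
  shows "i \<le> Suc k \<Longrightarrow> smooth_on U (v e i)"
proof (induction i)
  case 0
  then show ?case using U smooth_on_subset[OF smooth_s] by (simp add: regular_def)
next
  case (Suc i)
  then have "smooth_on U (v e i)" "open U" "zero_or_nonvanishing U (v e i)"
    using U e by (auto simp: regular_def)
  then show ?case by (auto intro!: smooth_on_diff smooth_on_lproj smooth_on_wd)
qed

context
  fixes U :: "complex set" and k :: nat and e :: real
  assumes U: "regular U k" and e: "\<bar>e\<bar> = 1"
begin

lemma regular_open_subset: "open U" "z \<in> U \<Longrightarrow> z \<in> M"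
  using U by (auto simp: regular_def)

lemma zero_or_nonvanishing_v: "i \<le> k \<Longrightarrow> zero_or_nonvanishing U (v e i)"
  using U e by (simp add: regular_def)

lemma smooth_v_U: "i \<le> Suc k \<Longrightarrow> smooth_on U (v e i)"
  by (rule smooth_v[OF U e])

lemma smooth_N: "i \<le> Suc k \<Longrightarrow> smooth_on U (N e i)"
  unfolding N_def by (intro smooth_intros regular_open_subset smooth_v_U)

lemma smooth_\<mu>: "i \<le> k \<Longrightarrow> smooth_on U (\<mu> e i)"
  unfolding \<mu>_def by (intro smooth_on_herm_quotient regular_open_subset smooth_on_wd smooth_v_U zero_or_nonvanishing_v) auto

lemma v_zero_Suc: "(\<And>z. z \<in> U \<Longrightarrow> v e i z = 0) \<Longrightarrow> z \<in> U \<Longrightarrow> v e (Suc i) z = 0"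
  using wd_zero_on[OF regular_open_subset(1), of z "v e i" e] by simp

text \<open>A section that vanishes on U makes all later ones vanish there, so a nonzero value of a
  later section leaves no zeros to the earlier ones.\<close>

lemma v_nonvanishing_mono:
  assumes "z \<in> U" "v e i z \<noteq> 0" "i \<le> Suc k" "j \<le> i" "w \<in> U" "j \<le> k"
  shows "v e j w \<noteq> 0"
proof
  assume "v e j w = 0"
  then have z: "\<forall>x\<in>U. v e j x = 0" using zero_or_nonvanishing_v[of j] assms by (auto simp: zero_or_nonvanishing_def)
  have "\<forall>x\<in>U. v e (j + d) x = 0" for d
    by (induction d) (use z v_zero_Suc in auto)
  from this[of "i - j"] show False using assms by simp
qed

lemma smooth_\<gamma>:
  assumes "i \<le> k"
  shows "smooth_on U (\<gamma> e i)"
  using zero_or_nonvanishing_v[OF assms] unfolding zero_or_nonvanishing_def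
proof
  assume "\<forall>x\<in>U. v e i x = 0"
  then show ?thesis
    by (subst smooth_on_cong[OF regular_open_subset(1), of _ "\<lambda>_. 0"]) (auto simp: \<gamma>_def N_def intro: smooth_on_const)
next
  assume "\<forall>x\<in>U. v e i x \<noteq> 0"
  then show ?thesis unfolding \<gamma>_def
    by (intro smooth_on_divide regular_open_subset smooth_N) (use assms in \<open>auto simp: N_def\<close>)
qed

text \<open>The hypothesis \<open>prev\<close> is the lowering equation one step below; it is proved
  in the same induction that uses this lemma.\<close>

lemma wc_N:
  assumes i: "i \<le> k" and z: "z \<in> U"
    and prev: "\<And>l. i = Suc l \<Longrightarrow> wd (- e) (v e i) z = - (\<gamma> e l z *s v e l z)"
  shows "wc e (N e i) z = \<mu> e i z * N e i z"
proof -
  have "wc e (N e i) z = herm (wd e (v e i) z) (v e i z) + herm (v e i z) (wd (- e) (v e i) z)"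
    unfolding N_def[abs_def] using i by (intro wc_herm[OF z] smooth_v_U) auto
  also have "herm (wd e (v e i) z) (v e i z) = \<mu> e i z * N e i z"
    by (cases "v e i z = 0") (auto simp: \<mu>_def N_def)
  also have "herm (v e i z) (wd (- e) (v e i) z) = 0"
  proof (cases i)
    case 0
    then show ?thesis using hor_s[OF regular_open_subset(2)[OF z], of "- e"] by (simp add: herm_eq_0_commute)
  next
    case (Suc l)
    then show ?thesis using prev[OF Suc] herm_v_Suc_v[of e l z]
      by (simp add: herm_minus_right herm_scale_right del: v.simps)
  qed
  finally show ?thesis by simp
qed

text \<open>By the second conjunct \<open>\<mu>\<close> is the logarithmic derivative of N, so the last one is the Toda
  equation.\<close>

lemma structure_equations:
  assumes i: "i \<le> k" and z: "z \<in> U"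
  shows "wd (- e) (v e (Suc i)) z = - (\<gamma> e i z *s v e i z) \<and>
    wc e (N e i) z = \<mu> e i z * N e i z \<and>
    (\<forall>l. i = Suc l \<longrightarrow> v e i z \<noteq> 0 \<longrightarrow> \<gamma> e i z = \<gamma> e l z + wc (- e) (\<mu> e i) z)"
  using i z
proof (induction i arbitrary: z)
  case 0
  note zM = regular_open_subset(2)[OF 0(2)]
  have D: "wd (- e) (wd e s) z = - (\<rho> z *s s z)" by (rule harmonic_s[OF e zM])
  have 1: "wd (- e) (v e (Suc 0)) z = - (\<rho> z *s s z)"
    using wd_cong_open[OF open_M zM, of "v e (Suc 0)" "wd e s" "- e"] v_1 D by simp
  \<comment> \<open>Differentiating horizontality identifies \<rho> with the squared norm of the
    first derivative, that is, with \<open>\<gamma> e 0\<close>.\<close>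
  have "0 = wc (- e) (\<lambda>z. herm (wd e s z) (s z)) z"
    using wc_zero_on[OF open_M zM] hor_s by simp
  also have "\<dots> = herm (wd (- e) (wd e s) z) (s z) + herm (wd e s z) (wd e s z)"
    using wc_herm[OF zM smooth_on_wd[OF open_M smooth_s] smooth_s, of "- e" e] by simp
  finally have "herm (wd e s z) (wd e s z) = \<rho> z"
    unfolding D by (simp add: herm_minus_left herm_scale_left unit_s[OF zM])
  then have "\<gamma> e 0 z = \<rho> z" using v_1[OF zM, of e] by (simp add: \<gamma>_def N_def unit_s[OF zM] del: v.simps(2))
  then show ?case using 1 wc_N[OF 0] by (simp del: v.simps(2))
next
  case (Suc l)
  then have l: "l \<le> k" "Suc l \<le> k" by auto
  note z = Suc.prems(2)
  have IH: "wd (- e) (v e (Suc l)) x = - (\<gamma> e l x *s v e l x)" if "x \<in> U" for x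
    using Suc.IH[OF l(1) that] by blast
  have N: "wc e (N e l) z = \<mu> e l z * N e l z" "wc e (N e (Suc l)) z = \<mu> e (Suc l) z * N e (Suc l) z"
    using Suc.IH[OF l(1) z] wc_N[OF l(2) z] IH[OF z] by blast+
  show ?case
  proof (cases "v e (Suc l) z = 0")
    case True
    then have 0: "\<And>x. x \<in> U \<Longrightarrow> v e (Suc l) x = 0"
      using zero_or_nonvanishing_v[OF l(2)] Suc.prems unfolding zero_or_nonvanishing_def by blast
    have "wd (- e) (v e (Suc (Suc l))) z = 0"
      by (rule wd_zero_on[OF regular_open_subset(1) Suc.prems(2)]) (rule v_zero_Suc[OF 0])
    then show ?thesis using True N by (simp del: v.simps)
  next
    case nz: False
    have nzl: "v e l x \<noteq> 0" if "x \<in> U" for x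
      using v_nonvanishing_mono[OF z nz _ _ that, of l] l by simp
    have sm: "smooth_on U (v e l)" "smooth_on U (v e (Suc l))" "smooth_on U (v e (Suc (Suc l)))"
      "smooth_on U (\<gamma> e l)" "smooth_on U (\<mu> e (Suc l))" "smooth_on U (\<mu> e l)"
      "smooth_on U (N e l)" "smooth_on U (N e (Suc l))"
      using l by (auto intro: smooth_v_U smooth_\<gamma> smooth_\<mu> smooth_N simp del: v.simps)
    have N0: "N e l z \<noteq> 0" "N e (Suc l) z \<noteq> 0" using nz nzl[OF z] by (simp_all add: N_def)
    \<comment> \<open>The logarithmic derivative of \<open>\<gamma> e l\<close> is the difference of
      those of \<open>N e (Suc l)\<close> and \<open>N e l\<close>.\<close>
    have "wc e (N e (Suc l)) z = wc e (\<lambda>x. \<gamma> e l x * N e l x) z"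
      by (rule wc_cong_open[OF regular_open_subset(1) z]) (use nzl in \<open>simp add: \<gamma>_def N_def\<close>)
    also have "\<dots> = \<gamma> e l z * wc e (N e l) z + wc e (\<gamma> e l) z * N e l z"
      by (rule wc_mult[OF z]) (use sm in auto)
    finally have "wc e (\<gamma> e l) z * N e l z = (\<gamma> e l z * (\<mu> e (Suc l) z - \<mu> e l z)) * N e l z"
      using N N0 by (simp add: \<gamma>_def algebra_simps)
    then have D\<gamma>: "wc e (\<gamma> e l) z = \<gamma> e l z * (\<mu> e (Suc l) z - \<mu> e l z)"
      using N0 by simp
    \<comment> \<open>The lowering equation holds on all of U, so it can be differentiated;
      commuting the operators then gives the mixed second derivative of
      \<open>v e (Suc l)\<close>.\<close>
    have "wd e (wd (- e) (v e (Suc l))) z = wd e (\<lambda>x. - (\<gamma> e l x *s v e l x)) z"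
      by (rule wd_cong_open[OF regular_open_subset(1) z]) (rule IH)
    also have "\<dots> = - (\<gamma> e l z *s wd e (v e l) z + wc e (\<gamma> e l) z *s v e l z)"
      using sm regular_open_subset(1) by (simp add: wd_minus[OF z] wd_scale[OF z] smooth_intros)
    also have "\<dots> = - (\<gamma> e l z *s v e (Suc l) z) - (\<gamma> e l z * \<mu> e (Suc l) z) *s v e l z"
      unfolding D\<gamma> wd_v by (simp add: vec_eq_iff algebra_simps del: v.simps)
    finally have DD: "wd (- e) (wd e (v e (Suc l))) z
        = - (\<gamma> e l z *s v e (Suc l) z) - (\<gamma> e l z * \<mu> e (Suc l) z) *s v e l z"
      using wd_commute[OF regular_open_subset(1) z sm(2)] by simp
    \<comment> \<open>The terms in \<open>v e l\<close> cancel below and leave c as the only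
      coefficient; orthogonality of the next section to \<open>v e (Suc l)\<close> then identifies c
      with \<open>\<gamma> e (Suc l)\<close>.\<close>
    define c where "c = \<gamma> e l z + wc (- e) (\<mu> e (Suc l)) z"
    have "wd (- e) (v e (Suc (Suc l))) z
        = wd (- e) (wd e (v e (Suc l))) z - wd (- e) (\<lambda>x. \<mu> e (Suc l) x *s v e (Suc l) x) z"
      unfolding v_Suc[of e "Suc l"] using regular_open_subset(1) sm smooth_on_wd
      by (intro wd_diff[OF z]) (auto intro!: smooth_intros simp del: v.simps)
    also have "wd (- e) (\<lambda>x. \<mu> e (Suc l) x *s v e (Suc l) x) z
        = \<mu> e (Suc l) z *s wd (- e) (v e (Suc l)) z + wc (- e) (\<mu> e (Suc l)) z *s v e (Suc l) z"
      by (rule wd_scale[OF z]) (use sm in auto)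
    finally have T: "wd (- e) (v e (Suc (Suc l))) z = - (c *s v e (Suc l) z)"
      unfolding DD IH[OF z] c_def by (simp add: vec_eq_iff algebra_simps del: v.simps)
    have "0 = wc (- e) (\<lambda>x. herm (v e (Suc (Suc l)) x) (v e (Suc l) x)) z"
      by (rule wc_zero_on[OF regular_open_subset(1) z, symmetric]) (rule herm_v_Suc_v)
    also have "\<dots> = herm (wd (- e) (v e (Suc (Suc l))) z) (v e (Suc l) z)
        + herm (v e (Suc (Suc l)) z) (wd e (v e (Suc l)) z)"
      using wc_herm[OF z sm(3,2), of "- e"] by simp
    also have "\<dots> = - c * N e (Suc l) z + N e (Suc (Suc l)) z"
      unfolding T wd_v
      by (simp add: N_def herm_minus_left herm_scale_left herm_add_right herm_scale_right
          herm_v_Suc_v del: v.simps)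
    finally have "c = \<gamma> e (Suc l) z" using N0 by (simp add: \<gamma>_def field_simps)
    then show ?thesis using T N unfolding c_def by (auto simp del: v.simps)
  qed
qed

lemma wd_minus_v_Suc:
  "i \<le> k \<Longrightarrow> z \<in> U \<Longrightarrow> wd (- e) (v e (Suc i)) z = - (\<gamma> e i z *s v e i z)"
  using structure_equations by blast

lemma wc_N_eq: "i \<le> k \<Longrightarrow> z \<in> U \<Longrightarrow> wc e (N e i) z = \<mu> e i z * N e i z"
  using structure_equations by blast

lemma toda:
  "Suc i \<le> k \<Longrightarrow> z \<in> U \<Longrightarrow> v e (Suc i) z \<noteq> 0 \<Longrightarrow>
    \<gamma> e (Suc i) z = \<gamma> e i z + wc (- e) (\<mu> e (Suc i)) z"
  using structure_equations by blast

text \<open>The right-hand side is the mixed second derivative of log N. It involves N alone, so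
  equal norms in both directions give equal terms in the Toda equations.\<close>

lemma wc_\<mu>:
  assumes i: "i \<le> k" and z: "z \<in> U" and nz: "v e i z \<noteq> 0"
  shows "wc (- e) (\<mu> e i) z =
    (wc (- e) (wc e (N e i)) z - wc e (N e i) z / N e i z * wc (- e) (N e i) z) / N e i z"
proof -
  have N0: "N e i z \<noteq> 0" using nz by (simp add: N_def)
  have "wc (- e) (wc e (N e i)) z = wc (- e) (\<lambda>x. \<mu> e i x * N e i x) z"
    by (rule wc_cong_open[OF regular_open_subset(1) z]) (rule wc_N_eq[OF i])
  also have "\<dots> = \<mu> e i z * wc (- e) (N e i) z + wc (- e) (\<mu> e i) z * N e i z"
    by (rule wc_mult[OF z]) (use i in \<open>auto intro: smooth_\<mu> smooth_N\<close>)
  finally show ?thesis using N0 wc_N_eq[OF i z] by (simp add: field_simps)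
qed

end

text \<open>The initial values \<open>\<gamma> e 0\<close> of the Toda equations do not depend on the direction, so neither
  do the norms.\<close>

lemma N_symmetric:
  assumes U: "regular U k" and e: "\<bar>e\<bar> = 1"
  shows "i \<le> Suc k \<Longrightarrow> z \<in> U \<Longrightarrow> N e i z = N (- e) i z"
proof (induction i arbitrary: z rule: less_induct)
  case (less i)
  have e': "\<bar>- e\<bar> = 1" using e by simp
  note zM = regular_open_subset(2)[OF U e less.prems(2)]
  consider "i = 0" | "i = 1" | l where "i = Suc (Suc l)"
    by (metis One_nat_def not0_implies_Suc)
  then show ?case
  proof cases
    case 1
    then show ?thesis by (simp add: N_def)
  next
    case 2
    have N1: "N f 1 z = \<rho> z" if "\<bar>f\<bar> = 1" for f
    proof -
      have D: "wd (- f) (wd f s) z = - (\<rho> z *s s z)" by (rule harmonic_s[OF that zM])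
      have "0 = wc (- f) (\<lambda>z. herm (wd f s z) (s z)) z"
        using wc_zero_on[OF open_M zM] hor_s by simp
      also have "\<dots> = herm (wd (- f) (wd f s) z) (s z) + herm (wd f s z) (wd f s z)"
        using wc_herm[OF zM smooth_on_wd[OF open_M smooth_s] smooth_s, of "- f" f] by simp
      finally show ?thesis
        unfolding D using v_1[OF zM, of f]
        by (simp add: N_def herm_minus_left herm_scale_left unit_s[OF zM] del: v.simps(2))
    qed
    then show ?thesis using N1[OF e] N1[OF e'] 2 by simp
  next
    case 3
    have l: "Suc l \<le> k" using 3 less.prems by simp
    have IH: "N e (Suc l) x = N (- e) (Suc l) x" "N e l x = N (- e) l x" if "x \<in> U" for x
      using less.IH[of "Suc l" x] less.IH[of l x] that l 3 by auto
    note z = less.prems(2)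
    show ?thesis
    proof (cases "v e (Suc l) z = 0")
      case True
      then have "N e (Suc l) z = 0" by (simp add: N_def)
      then have "v (- e) (Suc l) z = 0" using IH(1)[OF z] by (simp add: N_def)
      then have 0: "\<And>x. x \<in> U \<Longrightarrow> v e (Suc l) x = 0" "\<And>x. x \<in> U \<Longrightarrow> v (- e) (Suc l) x = 0"
        using True zero_or_nonvanishing_v[OF U e l] zero_or_nonvanishing_v[OF U e' l] z unfolding zero_or_nonvanishing_def by blast+
      show ?thesis
        using v_zero_Suc[OF U e 0(1) z] v_zero_Suc[OF U e' 0(2) z] 3 by (simp add: N_def del: v.simps)
    next
      case nz: False
      then have N0: "N e (Suc l) z \<noteq> 0" by (simp add: N_def)
      then have nz': "v (- e) (Suc l) z \<noteq> 0" using IH(1)[OF z] by (auto simp: N_def)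
      have cong: "wc f (N e (Suc l)) z = wc f (N (- e) (Suc l)) z" if "z \<in> U" for f z
        by (rule wc_cong_open[OF regular_open_subset(1)[OF U e] that IH(1)])
      have cong2: "wc f (wc g (N e (Suc l))) z = wc f (wc g (N (- e) (Suc l))) z" for f g
        by (rule wc_cong_open[OF regular_open_subset(1)[OF U e] z cong])
      \<comment> \<open>The norms agree on an open set, hence so do their derivatives;
        \<open>wc_commute\<close> matches the two orders of differentiation.\<close>
      have "wc (- e) (\<mu> e (Suc l)) z = wc e (\<mu> (- e) (Suc l)) z"
        using wc_\<mu>[OF U e l z nz] wc_\<mu>[OF U e' l z nz'] IH(1)[OF z] cong[OF z] cong2
          wc_commute[OF regular_open_subset(1)[OF U e] z smooth_N[OF U e, of "Suc l"], of e "- e"] l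
        by (simp add: mult_ac)
      moreover have "\<gamma> e l z = \<gamma> (- e) l z" using IH[OF z] by (simp add: \<gamma>_def)
      ultimately have "\<gamma> e (Suc l) z = \<gamma> (- e) (Suc l) z"
        using toda[OF U e l z nz] toda[OF U e' l z nz'] by simp
      then show ?thesis using N0 IH(1)[OF z] 3 by (simp add: \<gamma>_def)
    qed
  qed
qed

end

subsection \<open>Orthogonality relations and holomorphic differentials\<close>

context horizontal_harmonic_lift
begin

declare v.simps(2) [simp del]

text \<open>A section either vanishes on the open set or, by continuity, has no zero on a smaller
  one. The set is shrunk in this way for each index and each sign.\<close>

lemma exists_regular:
  assumes "open V" "V \<noteq> {}" "V \<subseteq> M"
  shows "\<exists>U\<subseteq>V. U \<noteq> {} \<and> regular U k"
proof (induction k)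
  case 0
  have "v e 0 z \<noteq> 0" if "z \<in> V" for e z
    using unit_s[of z] that assms(3) by auto
  then have "regular V 0" using assms by (auto simp: regular_def zero_or_nonvanishing_def)
  then show ?case using assms by blast
next
  case (Suc k)
  then obtain U where U: "U \<subseteq> V" "U \<noteq> {}" "regular U k" by blast
  have shrink: "\<exists>U'\<subseteq>U. U' \<noteq> {} \<and> open U' \<and> zero_or_nonvanishing U' (v e (Suc k))"
    if e: "\<bar>e\<bar> = 1" and U: "U \<noteq> {}" "regular U k" for e U
  proof (cases "\<forall>z\<in>U. v e (Suc k) z = 0")
    case True
    then show ?thesis using U by (intro exI[of _ U]) (auto simp: regular_def zero_or_nonvanishing_def)
  next
    case False
    have "continuous_on U (v e (Suc k))" "open U"
      using smooth_on_imp_continuous_on[OF smooth_v[OF U(2) e, of "Suc k"]] U by (auto simp: regular_def)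
    then have "open (U \<inter> v e (Suc k) -` (- {0}))"
      by (rule continuous_open_preimage) (simp add: open_Compl)
    then show ?thesis using False
      by (intro exI[of _ "U \<inter> v e (Suc k) -` (- {0})"]) (auto simp: zero_or_nonvanishing_def)
  qed
  obtain U1 where U1: "U1 \<subseteq> U" "U1 \<noteq> {}" "open U1" "zero_or_nonvanishing U1 (v 1 (Suc k))"
    using shrink[of 1, OF _ U(2,3)] by auto
  have r1: "regular U1 k" by (rule regular_subset[OF U(3) U1(3,1)])
  obtain U2 where U2: "U2 \<subseteq> U1" "U2 \<noteq> {}" "open U2" "zero_or_nonvanishing U2 (v (-1) (Suc k))"
    using shrink[of "-1", OF _ U1(2) r1] by auto
  have r2: "regular U2 k" by (rule regular_subset[OF r1 U2(3,1)])
  have "zero_or_nonvanishing U2 (v e i)" if "i \<le> Suc k" "\<bar>e\<bar> = 1" for e i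
  proof (cases "i = Suc k")
    case True
    have "e = 1 \<or> e = -1" using that(2) by linarith
    then show ?thesis using True U2(4) zero_or_nonvanishing_subset[OF U1(4) U2(1)] by auto
  next
    case False
    then show ?thesis using r2 that by (simp add: regular_def)
  qed
  then have "regular U2 (Suc k)" using r2 by (simp add: regular_def)
  then show ?case using U2 U1 U by blast
qed

text \<open>Unlike \<open>v e k\<close>, the iterated derivatives without projections are smooth on all of M, as the
  identity theorem requires.\<close>

primrec R :: "real \<Rightarrow> nat \<Rightarrow> complex \<Rightarrow> 'm hvec" where
  "R e 0 = s"
| "R e (Suc k) = wd e (R e k)"

definition A :: "real \<Rightarrow> nat \<Rightarrow> complex \<Rightarrow> complex" where
  "A e k z = herm (R e k z) (s z)"

definition C :: "real \<Rightarrow> nat \<Rightarrow> complex \<Rightarrow> complex" where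
  "C e k z = herm (R e k z) (jmul (s z))"

text \<open>The analytic form of isotropy of the rank two bundle, in functions smooth on all of M.
  Both signs occur because its i-th bundle is spanned by \<open>v 1 i\<close> and
  \<open>jmul (v (-1) i)\<close>.\<close>

definition isotropic :: "nat \<Rightarrow> bool" where
  "isotropic m \<longleftrightarrow> (\<forall>e i. \<forall>z\<in>M. \<bar>e\<bar> = 1 \<longrightarrow> 1 \<le> i \<longrightarrow> i \<le> m \<longrightarrow> A e i z = 0 \<and> C e i z = 0)"

lemma smooth_R: "smooth_on M (R e k)"
  by (induction k) (auto intro: smooth_s smooth_on_wd open_M)

lemma smooth_A: "smooth_on M (A e k)"
  unfolding A_def by (intro smooth_intros open_M smooth_R smooth_s)

lemma smooth_C: "smooth_on M (C e k)"
  unfolding C_def by (intro smooth_intros open_M smooth_R smooth_s)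

text \<open>Since \<open>v e 1\<close> is the derivative of s itself, \<open>R e m - v e m\<close> has no component along \<open>v e 0 = s\<close>;
  hence the lower bound on i.\<close>

inductive low :: "complex set \<Rightarrow> real \<Rightarrow> nat \<Rightarrow> (complex \<Rightarrow> 'm hvec) \<Rightarrow> bool" for U e m where
  low_zero: "(\<And>z. z \<in> U \<Longrightarrow> u z = 0) \<Longrightarrow> low U e m u"
| low_add: "low U e m u \<Longrightarrow> smooth_on U g \<Longrightarrow> 1 \<le> i \<Longrightarrow> i < m \<Longrightarrow>
    (\<And>z. z \<in> U \<Longrightarrow> w z = u z + g z *s v e i z) \<Longrightarrow> low U e m w"

lemma herm_low:
  assumes "low U e m u" "\<And>i. 1 \<le> i \<Longrightarrow> i < m \<Longrightarrow> herm (v e i z) x = 0" "z \<in> U"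
  shows "herm (u z) x = 0"
  using assms(1) by induction (use assms in \<open>auto simp: herm_add_left herm_scale_left\<close>)

context
  fixes U :: "complex set" and k :: nat and e :: real
  assumes U: "regular U k" and e: "\<bar>e\<bar> = 1"
begin

lemma smooth_low: "low U e m u \<Longrightarrow> m \<le> Suc (Suc k) \<Longrightarrow> smooth_on U u"
proof (induction rule: low.induct)
  case (low_zero u)
  then show ?case
    by (subst smooth_on_cong[OF regular_open_subset(1)[OF U e], of _ "\<lambda>_. 0"]) (auto intro: smooth_on_const)
next
  case (low_add u g i w)
  then show ?case
    by (subst smooth_on_cong[OF regular_open_subset(1)[OF U e], of _ "\<lambda>z. u z + g z *s v e i z"])
      (auto intro!: smooth_intros regular_open_subset(1)[OF U e] smooth_v[OF U e])
qed

text \<open>The derivative of \<open>v e i\<close> combines \<open>v e (Suc i)\<close> and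
  \<open>v e i\<close>, so differentiating raises the bound by one.\<close>

lemma low_wd: "low U e m u \<Longrightarrow> m \<le> Suc k \<Longrightarrow> low U e (Suc m) (wd e u)"
proof (induction rule: low.induct)
  case (low_zero u)
  then show ?case by (intro low.low_zero) (auto intro: wd_zero_on[OF regular_open_subset(1)[OF U e]])
next
  case (low_add u g i w)
  have i: "i \<le> k" using low_add by simp
  have sm: "smooth_on U u" "smooth_on U (v e i)" "smooth_on U (\<mu> e i)" "smooth_on U (wc e g)"
    "smooth_on U (\<lambda>z. g z *s v e i z)"
    using smooth_low[OF low_add.hyps(1)] low_add smooth_v[OF U e, of i] smooth_\<mu>[OF U e i]
      smooth_on_wc[OF regular_open_subset(1)[OF U e]] by (auto intro!: smooth_intros regular_open_subset(1)[OF U e])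
  have 1: "low U e (Suc m) (\<lambda>z. wd e u z + g z *s v e (Suc i) z)"
    by (rule low.low_add[of _ _ _ "wd e u" g "Suc i"]) (use low_add in auto)
  show ?case
  proof (rule low.low_add[OF 1, of "\<lambda>z. g z * \<mu> e i z + wc e g z" i])
    show "smooth_on U (\<lambda>z. g z * \<mu> e i z + wc e g z)"
      using sm low_add by (intro smooth_intros regular_open_subset(1)[OF U e])
    fix z assume z: "z \<in> U"
    have "wd e w z = wd e (\<lambda>z. u z + g z *s v e i z) z"
      by (rule wd_cong_open[OF regular_open_subset(1)[OF U e] z]) (use low_add in auto)
    also have "\<dots> = wd e u z + (g z *s wd e (v e i) z + wc e g z *s v e i z)"
      using wd_add[OF z sm(1,5)] wd_scale[OF z low_add.hyps(2) sm(2)] by simp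
    finally show "wd e w z = wd e u z + g z *s v e (Suc i) z + (g z * \<mu> e i z + wc e g z) *s v e i z"
      unfolding wd_v by (simp add: vec_eq_iff algebra_simps)
  qed (use low_add in auto)
qed

lemma R_eq_v_plus_low:
  "1 \<le> m \<Longrightarrow> m \<le> Suc k \<Longrightarrow> \<exists>u. low U e m u \<and> (\<forall>z\<in>U. R e m z = v e m z + u z)"
proof (induction m)
  case 0
  then show ?case by simp
next
  case (Suc m)
  show ?case
  proof (cases "m = 0")
    case True
    have "low U e (Suc m) (\<lambda>_. 0)" by (rule low_zero) simp
    then show ?thesis using True v_1 regular_open_subset(2)[OF U e] by (intro exI[of _ "\<lambda>_. 0"]) auto
  next
    case False
    then obtain u where u: "low U e m u" "\<forall>z\<in>U. R e m z = v e m z + u z"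
      using Suc by auto
    have m: "m \<le> k" using Suc by simp
    have "low U e (Suc m) (\<lambda>z. wd e u z + \<mu> e m z *s v e m z)"
      by (rule low_add[where i = m, OF low_wd[OF u(1)] smooth_\<mu>[OF U e m]]) (use Suc False in auto)
    moreover have "R e (Suc m) z = v e (Suc m) z + (wd e u z + \<mu> e m z *s v e m z)" if z: "z \<in> U" for z
    proof -
      have "R e (Suc m) z = wd e (\<lambda>z. v e m z + u z) z"
        unfolding R.simps by (rule wd_cong_open[OF regular_open_subset(1)[OF U e] z]) (use u(2) in blast)
      also have "\<dots> = wd e (v e m) z + wd e u z"
        by (rule wd_add[OF z]) (use smooth_v[OF U e] smooth_low[OF u(1)] m in auto)
      finally show ?thesis by (simp add: wd_v add_ac)
    qed
    ultimately show ?thesis by blast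
  qed
qed

text \<open>The passage from v to R is triangular, and x annihilates the remainder, a combination of
  sections of orders 1 to m - 1.\<close>

lemma herm_v_eq_herm_R:
  assumes "1 \<le> m" "m \<le> Suc k" "z \<in> U" "\<And>i. 1 \<le> i \<Longrightarrow> i < m \<Longrightarrow> herm (v e i z) x = 0"
  shows "herm (v e m z) x = herm (R e m z) x"
proof -
  obtain u where u: "low U e m u" "\<forall>z\<in>U. R e m z = v e m z + u z"
    using R_eq_v_plus_low assms by blast
  then show ?thesis using herm_low[OF u(1) assms(4,3)] assms(3) by (simp add: herm_add_left)
qed

lemma v_perp:
  assumes "isotropic m" "m \<le> Suc k" "1 \<le> i" "i \<le> m" "z \<in> U"
  shows "herm (v e i z) (s z) = 0" "herm (v e i z) (jmul (s z)) = 0"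
proof -
  have "herm (v e i z) (s z) = 0 \<and> herm (v e i z) (jmul (s z)) = 0"
    using assms(3,4)
  proof (induction i rule: less_induct)
    case (less i)
    have "herm (v e i z) (s z) = A e i z" "herm (v e i z) (jmul (s z)) = C e i z"
      unfolding A_def C_def by (rule herm_v_eq_herm_R; use less assms in force)+
    then show ?case using assms less.prems e regular_open_subset(2)[OF U e assms(5)] by (auto simp: isotropic_def)
  qed
  then show "herm (v e i z) (s z) = 0" "herm (v e i z) (jmul (s z)) = 0" by auto
qed

text \<open>One order beyond isotropy the lower sections are still perpendicular to s and j s, so A
  and C can be read off from v.\<close>

lemma herm_v_Suc_s:
  assumes "isotropic m" "m \<le> k" "z \<in> U"
  shows "herm (v e (Suc m) z) (s z) = A e (Suc m) z"
    "herm (v e (Suc m) z) (jmul (s z)) = C e (Suc m) z"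
  unfolding A_def C_def
  by (rule herm_v_eq_herm_R; use v_perp[OF assms(1) _ _ _ assms(3)] assms in simp)+

end

text \<open>All orthogonality relations below are obtained by differentiating a relation between sections
  of lower order that holds identically on U.\<close>

context
  fixes U :: "complex set" and k m :: nat and e :: real
  assumes U: "regular U k" and e: "\<bar>e\<bar> = 1" and m: "isotropic m" "m \<le> k"
begin

lemma abs_uminus_e: "\<bar>- e\<bar> = 1"
  using e by simp

lemma open_U: "open U"
  by (rule regular_open_subset(1)[OF U e])

text \<open>Induction on l: the derivative of sign - e lowers \<open>v e i\<close> and raises
  \<open>v e l\<close>.\<close>

lemma v_perp_v:
  assumes "l < i" "i \<le> m" "z \<in> U"
  shows "herm (v e i z) (v e l z) = 0"
  using assms
proof (induction l arbitrary: i z)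
  case 0
  then show ?case using v_perp(1)[OF U e m(1), of i z] m by simp
next
  case (Suc l)
  obtain i' where i': "i = Suc i'" using Suc.prems by (cases i) auto
  have "0 = wc (- e) (\<lambda>z. herm (v e i z) (v e l z)) z"
    by (rule wc_zero_on[OF open_U Suc.prems(3), symmetric]) (use Suc in auto)
  also have "\<dots> = herm (wd (- e) (v e i) z) (v e l z) + herm (v e i z) (wd e (v e l) z)"
    using wc_herm[OF Suc.prems(3) smooth_v[OF U e, of i] smooth_v[OF U e, of l], of "- e"]
      Suc.prems m by simp
  also have "herm (wd (- e) (v e i) z) (v e l z) = 0"
    unfolding i' using wd_minus_v_Suc[OF U e, of i' z] Suc.IH[of i' z] Suc.prems m i'
    by (simp add: herm_minus_left herm_scale_left)
  also have "herm (v e i z) (wd e (v e l) z) = herm (v e i z) (v e (Suc l) z)"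
    using Suc.IH[of i z] Suc.prems by (simp add: wd_v herm_add_right herm_scale_right)
  finally show ?case by simp
qed

text \<open>For l < m the relation between \<open>v e m\<close> and \<open>v e l\<close> is
  differentiated so as to raise the former. The index l = 0 is left out: there the product is
  \<open>A e (Suc m)\<close>.\<close>

lemma v_Suc_perp_v:
  assumes l: "1 \<le> l" "l \<le> m" and z: "z \<in> U"
  shows "herm (v e (Suc m) z) (v e l z) = 0"
proof (cases "l = m")
  case True
  then show ?thesis using herm_v_Suc_v by simp
next
  case False
  obtain l' where l': "l = Suc l'" using l by (cases l) auto
  have "0 = wc e (\<lambda>z. herm (v e m z) (v e l z)) z"
    by (rule wc_zero_on[OF open_U z, symmetric]) (use v_perp_v False l in auto)
  also have "\<dots> = herm (wd e (v e m) z) (v e l z) + herm (v e m z) (wd (- e) (v e l) z)"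
    using wc_herm[OF z smooth_v[OF U e, of m] smooth_v[OF U e, of l], of e] l m by simp
  also have "herm (wd e (v e m) z) (v e l z) = herm (v e (Suc m) z) (v e l z)"
    using v_perp_v[of l m z] False l z by (simp add: wd_v herm_add_left herm_scale_left)
  also have "herm (v e m z) (wd (- e) (v e l) z) = 0"
    using wd_minus_v_Suc[OF U e, of l' z] v_perp_v[of l' m z] z l l' m
    by (simp add: herm_minus_right herm_scale_right)
  finally show ?thesis by simp
qed

text \<open>The sign changes of j and of the second slot cancel, so the derivative of sign - e
  lowers \<open>v e i\<close> while it raises \<open>v (- e) l\<close>.\<close>

lemma v_perp_jmul_v:
  assumes "i \<le> m" "l \<le> m" "z \<in> U"
  shows "herm (v e i z) (jmul (v (- e) l z)) = 0"
  using assms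
proof (induction l arbitrary: i z)
  case 0
  then show ?case using v_perp(2)[OF U e m(1), of i z] m by (cases "i = 0") auto
next
  case (Suc l)
  note z = Suc.prems(3)
  show ?case
  proof (cases i)
    case 0
    then show ?thesis
      using v_perp(2)[OF U abs_uminus_e m(1), of "Suc l" z] Suc.prems m by (simp add: herm_jmul_right[of "s z"])
  next
    case (Suc i')
    have "0 = wc (- e) (\<lambda>z. herm (v e i z) (jmul (v (- e) l z))) z"
      by (rule wc_zero_on[OF open_U z, symmetric]) (use Suc.IH Suc.prems in auto)
    also have "\<dots> = herm (wd (- e) (v e i) z) (jmul (v (- e) l z))
        + herm (v e i z) (jmul (wd (- e) (v (- e) l) z))"
      using wc_herm[OF z smooth_v[OF U e, of i] smooth_on_linear[OF bounded_linear_jmul open_U smooth_v[OF U abs_uminus_e, of l]], of "- e"]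
        wd_jmul[OF z smooth_v[OF U abs_uminus_e, of l], of e] Suc.prems m by simp
    also have "herm (wd (- e) (v e i) z) (jmul (v (- e) l z)) = 0"
      using wd_minus_v_Suc[OF U e, of i' z] Suc.IH[of i' z] Suc.prems m Suc
      by (simp add: herm_minus_left herm_scale_left)
    also have "herm (v e i z) (jmul (wd (- e) (v (- e) l) z)) = herm (v e i z) (jmul (v (- e) (Suc l) z))"
      using Suc.IH[of i z] Suc.prems by (simp add: wd_v jmul_add jmul_scale herm_add_right herm_scale_right)
    finally show ?thesis by simp
  qed
qed

lemma v_Suc_perp_jmul_v:
  assumes l: "1 \<le> l" "l \<le> m" and z: "z \<in> U"
  shows "herm (v e (Suc m) z) (jmul (v (- e) l z)) = 0"
proof -
  obtain l' where l': "l = Suc l'" using l by (cases l) auto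
  have "0 = wc e (\<lambda>z. herm (v e m z) (jmul (v (- e) l z))) z"
    by (rule wc_zero_on[OF open_U z, symmetric]) (use v_perp_jmul_v l in auto)
  also have "\<dots> = herm (wd e (v e m) z) (jmul (v (- e) l z)) + herm (v e m z) (jmul (wd e (v (- e) l) z))"
    using wc_herm[OF z smooth_v[OF U e, of m] smooth_on_linear[OF bounded_linear_jmul open_U smooth_v[OF U abs_uminus_e, of l]], of e]
        wd_jmul[OF z smooth_v[OF U abs_uminus_e, of l], of "- e"] l m by simp
  also have "herm (wd e (v e m) z) (jmul (v (- e) l z)) = herm (v e (Suc m) z) (jmul (v (- e) l z))"
    using v_perp_jmul_v[of m l z] l z by (simp add: wd_v herm_add_left herm_scale_left)
  also have "herm (v e m z) (jmul (wd e (v (- e) l) z)) = 0"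
    using wd_minus_v_Suc[OF U abs_uminus_e, of l' z] v_perp_jmul_v[of m l' z] z l l' m
    by (simp add: jmul_minus jmul_scale herm_minus_right herm_scale_right)
  finally show ?thesis by simp
qed

text \<open>This makes the pair of sections at index m + 1 orthogonal, hence a frame.\<close>

lemma v_Suc_perp_jmul_v_Suc:
  assumes "1 \<le> m" and z: "z \<in> U"
  shows "herm (v e (Suc m) z) (jmul (v (- e) (Suc m) z)) = 0"
proof -
  have "0 = wc (- e) (\<lambda>z. herm (v e (Suc m) z) (jmul (v (- e) m z))) z"
    by (rule wc_zero_on[OF open_U z, symmetric]) (use v_Suc_perp_jmul_v assms in auto)
  also have "\<dots> = herm (wd (- e) (v e (Suc m)) z) (jmul (v (- e) m z))
      + herm (v e (Suc m) z) (jmul (wd (- e) (v (- e) m) z))"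
    using wc_herm[OF z smooth_v[OF U e, of "Suc m"] smooth_on_linear[OF bounded_linear_jmul open_U smooth_v[OF U abs_uminus_e, of m]], of "- e"]
        wd_jmul[OF z smooth_v[OF U abs_uminus_e, of m], of e] m by simp
  also have "herm (wd (- e) (v e (Suc m)) z) (jmul (v (- e) m z)) = 0"
    using wd_minus_v_Suc[OF U e, of m z] v_perp_jmul_v[of m m z] z m
    by (simp add: herm_minus_left herm_scale_left)
  also have "herm (v e (Suc m) z) (jmul (wd (- e) (v (- e) m) z)) = herm (v e (Suc m) z) (jmul (v (- e) (Suc m) z))"
    using v_Suc_perp_jmul_v[of m z] z assms by (simp add: wd_v jmul_add jmul_scale herm_add_right herm_scale_right)
  finally show ?thesis by simp
qed

text \<open>The derivative lowers the first factor to order m or raises s and j s to order 1; the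
  relations above annihilate both terms.\<close>

lemma wc_A_C_regular:
  assumes "1 \<le> m" and z: "z \<in> U"
  shows "wc (- e) (A e (Suc m)) z = 0" "wc (- e) (C e (Suc m)) z = 0"
proof -
  have zM: "z \<in> M" by (rule regular_open_subset(2)[OF U e z])
  have sU: "smooth_on U s" using smooth_v[OF U e, of 0] by simp
  have T: "wd (- e) (v e (Suc m)) z = - (\<gamma> e m z *s v e m z)"
    by (rule wd_minus_v_Suc[OF U e m(2) z])
  have "wc (- e) (A e (Suc m)) z = wc (- e) (\<lambda>z. herm (v e (Suc m) z) (s z)) z"
    by (rule wc_cong_open[OF open_U z]) (simp add: herm_v_Suc_s[OF U e m])
  also have "\<dots> = herm (wd (- e) (v e (Suc m)) z) (s z) + herm (v e (Suc m) z) (wd e s z)"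
    using wc_herm[OF z smooth_v[OF U e, of "Suc m"] sU, of "- e"] m by simp
  also have "\<dots> = 0"
    using v_perp(1)[OF U e m(1), of m z] v_Suc_perp_v[of 1 z] assms z m v_1[OF zM, of e]
    by (simp add: T herm_minus_left herm_scale_left)
  finally show "wc (- e) (A e (Suc m)) z = 0" .
  have "wc (- e) (C e (Suc m)) z = wc (- e) (\<lambda>z. herm (v e (Suc m) z) (jmul (s z))) z"
    by (rule wc_cong_open[OF open_U z]) (simp add: herm_v_Suc_s[OF U e m])
  also have "\<dots> = herm (wd (- e) (v e (Suc m)) z) (jmul (s z)) + herm (v e (Suc m) z) (jmul (wd (- e) s z))"
    using wc_herm[OF z smooth_v[OF U e, of "Suc m"] smooth_on_linear[OF bounded_linear_jmul open_U sU], of "- e"]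
      wd_jmul[OF z sU, of e] m by simp
  also have "\<dots> = 0"
    using v_perp(2)[OF U e m(1), of m z] v_Suc_perp_jmul_v[of 1 z] assms z m v_1[OF zM, of "- e"]
    by (simp add: T herm_minus_left herm_scale_left)
  finally show "wc (- e) (C e (Suc m)) z = 0" .
qed

end

text \<open>Regular sets meet every nonempty open subset of M, in particular the set where g is
  nonzero.\<close>

lemma zero_if_zero_on_regular:
  assumes g: "continuous_on M g" and z: "z \<in> M" 
    and zero: "\<And>U w. regular U k \<Longrightarrow> w \<in> U \<Longrightarrow> g w = (0 :: complex)"
  shows "g z = 0"
proof (rule ccontr)
  assume nz: "g z \<noteq> 0"
  have "open (M \<inter> g -` (- {0}))" by (rule continuous_open_preimage[OF g open_M]) (simp add: open_Compl)
  then obtain U where "U \<subseteq> M \<inter> g -` (- {0})" "U \<noteq> {}" "regular U k"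
    using exists_regular[of "M \<inter> g -` (- {0})" k] nz z by blast
  then show False using zero[of U] by blast
qed

lemma wc_A_C:
  assumes e: "\<bar>e\<bar> = 1" and m: "isotropic m" "1 \<le> m" and z: "z \<in> M"
  shows "wc (- e) (A e (Suc m)) z = 0" "wc (- e) (C e (Suc m)) z = 0"
proof -
  have "continuous_on M (wc (- e) (A e (Suc m)))" "continuous_on M (wc (- e) (C e (Suc m)))"
    by (intro smooth_on_imp_continuous_on smooth_on_wc open_M smooth_A smooth_C)+
  then show "wc (- e) (A e (Suc m)) z = 0" "wc (- e) (C e (Suc m)) z = 0"
    using wc_A_C_regular[OF _ e m(1) order_refl m(2)]
    by (blast intro: zero_if_zero_on_regular[OF _ z, of _ m])+
qed

lemma A_C_identity:
  assumes e: "\<bar>e\<bar> = 1" and m: "isotropic m" "1 \<le> m"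
    and V: "open V" "V \<noteq> {}" "V \<subseteq> M" and z: "z \<in> M"
  shows "(\<And>w. w \<in> V \<Longrightarrow> A e (Suc m) w = 0) \<Longrightarrow> A e (Suc m) z = 0"
    "(\<And>w. w \<in> V \<Longrightarrow> C e (Suc m) w = 0) \<Longrightarrow> C e (Suc m) z = 0"
  by (rule wirtinger_identity_theorem[OF open_M connected_M e smooth_A wc_A_C(1)[OF e m] V _ z], assumption+)
    (rule wirtinger_identity_theorem[OF open_M connected_M e smooth_C wc_A_C(2)[OF e m] V _ z], assumption+)

lemma isotropic_1: "isotropic 1"
  by (auto simp: isotropic_def A_def C_def hor_s hor_js le_Suc_eq)

text \<open>Differentiating \<open>herm (R e i z) (R (- e) l z)\<close> moves the derivatives one by
  one from the first factor to the second, at fixed total order.\<close>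

lemma A_reverse:
  assumes "\<And>i z. z \<in> M \<Longrightarrow> 1 \<le> i \<Longrightarrow> i \<le> m \<Longrightarrow> A e i z = 0" "1 \<le> m" "z \<in> M"
  shows "A (- e) m z = 0"
proof -
  have "herm (R e i z) (R (- e) l z) = 0" if "1 \<le> i + l" "i + l \<le> m" "z \<in> M" for i l z
    using that
  proof (induction l arbitrary: i z)
    case 0
    then show ?case using assms(1)[of z i] by (simp add: A_def)
  next
    case (Suc l)
    note z = Suc.prems(3)
    have "wc e (\<lambda>z. herm (R e i z) (R (- e) l z)) z = 0"
    proof (cases "i + l = 0")
      \<comment> \<open>Here the product is the constant 1 instead of 0, but its derivative vanishes
        all the same.\<close>
      case True
      then show ?thesis
        using wc_cong_open[OF open_M z, of "\<lambda>z. herm (R e i z) (R (- e) l z)" "\<lambda>_. 1" e]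
        by (simp add: unit_s)
    next
      case False
      then show ?thesis using Suc by (intro wc_zero_on[OF open_M z]) auto
    qed
    moreover have "wc e (\<lambda>z. herm (R e i z) (R (- e) l z)) z
      = herm (R e (Suc i) z) (R (- e) l z) + herm (R e i z) (R (- e) (Suc l) z)"
      using wc_herm[OF z smooth_R smooth_R, of e e i "- e" l] by simp
    ultimately show ?case using Suc.IH[of "Suc i" z] Suc.prems by simp
  qed
  from this[of 0 m z] show ?thesis using assms by (simp add: A_def herm_eq_0_commute)
qed

end

subsection \<open>Isotropy orders\<close>

text \<open>A real dimension count: a nonzero x, the \<open>b i\<close> and the
  \<open>\<i> *s b i\<close> would be 2d + 1 nonzero, pairwise orthogonal vectors in real dimension
  2d.\<close>

lemma eq_0_if_perp_orthogonal_basis: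
  fixes b :: "nat \<Rightarrow> 'm::finite hvec"
  defines "d \<equiv> 2 * CARD('m)"
  assumes orth: "\<And>i j. i < d \<Longrightarrow> j < i \<Longrightarrow> herm (b i) (b j) = 0"
    and nz: "\<And>i. i < d \<Longrightarrow> b i \<noteq> 0"
    and x: "\<And>i. i < d \<Longrightarrow> herm x (b i) = 0"
  shows "x = 0"
proof (rule ccontr)
  assume "x \<noteq> 0"
  define f where "f = (\<lambda>i. if i < d then b i else if i < 2 * d then \<i> *s b (i - d) else x)"
  have orth': "herm (b i) (b j) = 0" if "i < d" "j < d" "i \<noteq> j" for i j
    using orth[of i j] herm_eq_0_sym[OF orth[of j i]] that by (cases "j < i") auto
  have fnz: "f i \<noteq> 0" for i
    using nz[of i] nz[of "i - d"] \<open>x \<noteq> 0\<close> by (auto simp: f_def)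
  have ff: "f i \<bullet> f j = 0" if "j < i" "i \<le> 2 * d" for i j
  proof -
    have x': "herm x (b i) = 0" "herm (b i) x = 0" if "i < d" for i
      using x[OF that] herm_eq_0_sym[OF x[OF that]] by simp_all
    have "i < d \<or> d \<le> i \<and> i < 2 * d \<and> j < d \<or> d \<le> j \<and> i < 2 * d \<or> i = 2 * d"
      using that by linarith
    then consider "i < d" | "d \<le> i" "i < 2 * d" "j < d" | "d \<le> j" "i < 2 * d" | "i = 2 * d"
      by blast
    then show ?thesis
    proof cases
      case 1
      then have "f i = b i" "f j = b j" using that by (simp_all add: f_def)
      then show ?thesis using orth'[of i j] 1 that by (simp add: inner_eq_Re_herm)
    next
      case 2
      then have "f i = \<i> *s b (i - d)" "f j = b j" by (simp_all add: f_def)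
      moreover have "Re (\<i> * herm (b (i - d)) (b j)) = 0"
        using orth'[of "i - d" j] 2 herm_self[of "b j"] by (cases "i - d = j") auto
      ultimately show ?thesis by (simp add: inner_eq_Re_herm herm_scale_left)
    next
      case 3
      then have "f i = \<i> *s b (i - d)" "f j = \<i> *s b (j - d)" using that by (simp_all add: f_def)
      then show ?thesis using orth'[of "i - d" "j - d"] 3 that
        by (simp add: inner_eq_Re_herm herm_scale_left herm_scale_right)
    next
      case 4
      have "f i = x" using 4 by (simp add: f_def)
      moreover have "f j = b j \<and> j < d \<or> f j = \<i> *s b (j - d) \<and> j - d < d"
      proof (cases "j < d")
        case False
        then have "j < 2 * d" "j - d < d" using 4 that by linarith+
        then show ?thesis using False by (simp add: f_def)
      qed (simp add: f_def)
      ultimately show ?thesis using x'(1)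
        by (auto simp: inner_eq_Re_herm herm_scale_right)
    qed
  qed
  have ff': "f i \<bullet> f j = 0" if "i \<le> 2 * d" "j \<le> 2 * d" "i \<noteq> j" for i j
    using ff[of j i] ff[of i j] that by (cases "j < i") (auto simp: inner_commute)
  have inj: "inj_on f {..2 * d}"
  proof (rule inj_onI, rule ccontr)
    fix i j assume "i \<in> {..2 * d}" "j \<in> {..2 * d}" "f i = f j" "i \<noteq> j"
    then have "f i \<bullet> f i = 0" using ff'[of i j] by simp
    then show False using fnz[of i] by simp
  qed
  have "pairwise orthogonal (f ` {..2 * d})"
    unfolding pairwise_def orthogonal_def using ff' by auto
  then have "independent (f ` {..2 * d})"
    by (rule pairwise_orthogonal_independent) (use fnz in auto)
  then have "card (f ` {..2 * d}) \<le> DIM('m hvec)"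
    by (rule independent_card_le)
  then show False using card_image[OF inj] by (simp add: d_def)
qed

lemma lproj_jmul: "lproj (jmul b) (jmul u) = jmul (lproj b u)"
  by (simp add: lproj_def herm_jmul_jmul jmul_scale)

lemma cspan2_scale_0:
  assumes "c \<noteq> 0"
  shows "cspan2 (c *s a) 0 = cspan2 a 0"
proof (intro set_eqI iffI)
  fix x assume "x \<in> cspan2 (c *s a) 0"
  then obtain \<alpha> where "x = \<alpha> *s (c *s a)" by (auto simp: cspan2_iff)
  then have "x = (\<alpha> * c) *s a + 0 *s 0" by simp
  then show "x \<in> cspan2 a 0" unfolding cspan2_iff by blast
next
  fix x assume "x \<in> cspan2 a 0"
  then obtain \<alpha> where "x = \<alpha> *s a" by (auto simp: cspan2_iff)
  then have "x = (\<alpha> / c) *s (c *s a) + 0 *s 0" using assms by simp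
  then show "x \<in> cspan2 (c *s a) 0" unfolding cspan2_iff by blast
qed

text \<open>The first frame computes the image; the second makes the limit defining the next bundle
  agree with it.\<close>

lemma harmonic_sequence_step:
  assumes e: "frame2 U e1 e2" and f: "frame2 U f1 f2"
    and seq: "\<And>x. x \<in> U \<Longrightarrow> harmonic_sequence \<psi> i x = cspan2 (e1 x) (e2 x)"
    and step: "\<And>x. x \<in> U \<Longrightarrow> perp2 (e1 x) (e2 x) (wd 1 e1 x) = f1 x"
      "\<And>x. x \<in> U \<Longrightarrow> perp2 (e1 x) (e2 x) (wd 1 e2 x) = f2 x"
    and x: "x \<in> U"
  shows "A'_image (harmonic_sequence \<psi> i) x = cspan2 (f1 x) (f2 x)"
    "harmonic_sequence \<psi> (Suc i) x = cspan2 (f1 x) (f2 x)"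
proof -
  have A: "A'_image (harmonic_sequence \<psi> i) x = cspan2 (f1 x) (f2 x)" if "x \<in> U" for x
    using A'_image_frame2[OF e seq that] step[OF that] by simp
  show "A'_image (harmonic_sequence \<psi> i) x = cspan2 (f1 x) (f2 x)" by (rule A[OF x])
  show "harmonic_sequence \<psi> (Suc i) x = cspan2 (f1 x) (f2 x)"
    using next_bundle_frame2[OF f A x] by simp
qed

text \<open>Nothing is required of f1 and f2, so the image is available one index beyond the known
  frames.\<close>

lemma A'_image_frame2_step:
  assumes "frame2 U e1 e2" "\<And>x. x \<in> U \<Longrightarrow> \<psi> x = cspan2 (e1 x) (e2 x)" "x \<in> U"
    "perp2 (e1 x) (e2 x) (wd 1 e1 x) = f1" "perp2 (e1 x) (e2 x) (wd 1 e2 x) = f2"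
  shows "A'_image \<psi> x = cspan2 f1 f2"
  using A'_image_frame2[OF assms(1-3)] assms(4,5) by simp

context horizontal_harmonic_lift
begin

section \<open>Frames of both harmonic sequences over a regular set\<close>

context
  fixes U :: "complex set" and k :: nat
  assumes U: "regular U k"
begin

lemma frame2_v: "i \<le> k \<Longrightarrow> frame2 U (v 1 i) (\<lambda>_. 0)"
  using U smooth_v[OF U, of 1 i]
  by (auto simp: frame2_def regular_def smooth_on_const zero_or_nonvanishing_def)

lemma frame2_jmul_v: "i \<le> k \<Longrightarrow> frame2 U (\<lambda>x. jmul (v (-1) i x)) (\<lambda>_. 0)"
  using U smooth_v[OF U, of "-1" i] smooth_on_linear[OF bounded_linear_jmul, of U "v (-1) i"]
  by (auto simp: frame2_def regular_def smooth_on_const zero_or_nonvanishing_def)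

lemma perp2_v: "perp2 (v 1 i x) 0 (wd 1 (v 1 i) x) = v 1 (Suc i) x"
  by (simp add: perp2_def v.simps(2))

lemma perp2_jmul_v:
  assumes "i \<le> k" "x \<in> U"
  shows "perp2 (jmul (v (-1) i x)) 0 (wd 1 (\<lambda>x. jmul (v (-1) i x)) x) = jmul (v (-1) (Suc i) x)"
  using smooth_v[OF U, of "-1" i] assms
  by (simp add: perp2_def wd_jmul[OF assms(2)] lproj_jmul jmul_diff v.simps(2))

lemma cp_sequence:
  "i \<le> k \<Longrightarrow> x \<in> U \<Longrightarrow> harmonic_sequence (\<lambda>z. cp_point (s z)) i x = cspan2 (v 1 i x) 0"
proof (induction i arbitrary: x)
  case 0
  then show ?case by (simp add: cp_point_eq_cspan2)
next
  case (Suc i)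
  show ?case
    by (rule harmonic_sequence_step(2)[OF frame2_v[of i] frame2_v[OF Suc.prems(1)] _ perp2_v _ Suc.prems(2)])
      (use Suc in \<open>auto simp: perp2_def lproj_def\<close>)
qed

lemma A'_image_cp_sequence:
  "i \<le> k \<Longrightarrow> x \<in> U \<Longrightarrow>
    A'_image (harmonic_sequence (\<lambda>z. cp_point (s z)) i) x = cspan2 (v 1 (Suc i) x) 0"
  by (rule A'_image_frame2_step[OF frame2_v cp_sequence _ perp2_v]) (auto simp: perp2_def lproj_def)

text \<open>From [j s] onwards the sequence follows the other direction, since the z-derivative of j
  u is j applied to the conjugate derivative of u.\<close>

lemma cp_sequence_jmul:
  assumes "\<And>x. x \<in> U \<Longrightarrow> harmonic_sequence (\<lambda>z. cp_point (s z)) p x = cspan2 (jmul (s x)) 0"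
  shows "i \<le> k \<Longrightarrow> x \<in> U \<Longrightarrow>
    harmonic_sequence (\<lambda>z. cp_point (s z)) (p + i) x = cspan2 (jmul (v (-1) i x)) 0"
proof (induction i arbitrary: x)
  case 0
  then show ?case by (simp add: assms)
next
  case (Suc i)
  show ?case unfolding add_Suc_right
    by (rule harmonic_sequence_step(2)[OF frame2_jmul_v[of i] frame2_jmul_v[OF Suc.prems(1)] _ perp2_jmul_v _ Suc.prems(2)])
      (use Suc in \<open>auto simp: perp2_def lproj_def\<close>)
qed

lemma A'_image_cp_sequence_jmul:
  assumes "\<And>x. x \<in> U \<Longrightarrow> harmonic_sequence (\<lambda>z. cp_point (s z)) p x = cspan2 (jmul (s x)) 0"
    "i \<le> k" "x \<in> U"
  shows "A'_image (harmonic_sequence (\<lambda>z. cp_point (s z)) (p + i)) x = cspan2 (jmul (v (-1) (Suc i) x)) 0"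
  by (rule A'_image_frame2_step[OF frame2_jmul_v cp_sequence_jmul[OF assms(1)] _ perp2_jmul_v])
    (use assms in \<open>auto simp: perp2_def lproj_def\<close>)

context
  fixes m :: nat and \<psi> :: "complex \<Rightarrow> 'm hvec set"
  assumes m: "isotropic m" "1 \<le> m" "m < k"
    and \<psi>: "\<And>z. z \<in> M \<Longrightarrow> \<psi> z = hp_point (s z)"
begin

text \<open>Hence projecting the derivative off \<open>v e i\<close> alone already projects it off
  the rank two fibre.\<close>

lemma wd_v_perp_jmul_v:
  assumes "\<bar>e\<bar> = 1" "i \<le> m" "x \<in> U"
  shows "herm (wd e (v e i) x) (jmul (v (- e) i x)) = 0"
proof -
  have mk: "m \<le> k" using m by simp
  have "herm (v e (Suc i) x) (jmul (v (- e) i x)) = 0"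
    using v_perp_jmul_v[OF U assms(1) m(1) mk, of "Suc i" i x]
      v_Suc_perp_jmul_v[OF U assms(1) m(1) mk m(2) order_refl assms(3)] assms(2,3)
    by (cases "i = m") auto
  then show ?thesis
    using v_perp_jmul_v[OF U assms(1) m(1) mk assms(2,2,3)]
    by (simp add: wd_v herm_add_left herm_scale_left)
qed

lemma frame2_hp:
  assumes "i \<le> Suc m"
  shows "frame2 U (v 1 i) (\<lambda>x. jmul (v (-1) i x))"
proof -
  have "herm (v 1 i x) (jmul (v (-1) i x)) = 0" if "x \<in> U" for x
    using v_perp_jmul_v[OF U _ m(1), of 1 i i x] v_Suc_perp_jmul_v_Suc[OF U _ m(1) _ m(2) that, of 1]
      m assms that by (cases "i = Suc m") auto
  then show ?thesis
    using frame2_v[of i] frame2_jmul_v[of i] assms m by (auto simp: frame2_def)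
qed

lemma perp2_hp:
  assumes "i \<le> m" "x \<in> U"
  shows "perp2 (v 1 i x) (jmul (v (-1) i x)) (wd 1 (v 1 i) x) = v 1 (Suc i) x"
    "perp2 (v 1 i x) (jmul (v (-1) i x)) (wd 1 (\<lambda>x. jmul (v (-1) i x)) x) = jmul (v (-1) (Suc i) x)"
proof -
  show "perp2 (v 1 i x) (jmul (v (-1) i x)) (wd 1 (v 1 i) x) = v 1 (Suc i) x"
    using wd_v_perp_jmul_v[of 1, OF _ assms] by (simp add: perp2_def v.simps(2) lproj_eq_0)
  have "herm (jmul (wd (-1) (v (-1) i) x)) (v 1 i x) = 0"
    using wd_v_perp_jmul_v[of "-1", OF _ assms] by (simp add: herm_jmul_left)
  then show "perp2 (v 1 i x) (jmul (v (-1) i x)) (wd 1 (\<lambda>x. jmul (v (-1) i x)) x) = jmul (v (-1) (Suc i) x)"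
    using smooth_v[OF U, of "-1" i] assms m
    by (simp add: perp2_def wd_jmul[OF assms(2)] lproj_jmul jmul_diff v.simps(2) lproj_eq_0)
qed

lemma hp_sequence:
  "i \<le> Suc m \<Longrightarrow> x \<in> U \<Longrightarrow> harmonic_sequence \<psi> i x = cspan2 (v 1 i x) (jmul (v (-1) i x))"
proof (induction i arbitrary: x)
  case 0
  then show ?case using \<psi> U by (auto simp: hp_point_eq_cspan2 regular_def)
next
  case (Suc i)
  show ?case
    by (rule harmonic_sequence_step(2)[OF frame2_hp[of i] frame2_hp[OF Suc.prems(1)] _ perp2_hp Suc.prems(2)])
      (use Suc in auto)
qed

lemma A'_image_hp_sequence:
  "x \<in> U \<Longrightarrow> A'_image (harmonic_sequence \<psi> m) x = cspan2 (v 1 (Suc m) x) (jmul (v (-1) (Suc m) x))"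
  by (rule A'_image_frame2_step[OF frame2_hp[of m] hp_sequence _ perp2_hp]) auto

end

end

text \<open>Isotropy up to m provides a frame at index m + 1 over one regular set. Perpendicularity
  makes A and C of order m + 1 vanish there, and the identity theorem does the rest.\<close>

lemma isotropic_if_isotropic_up_to:
  assumes \<psi>: "\<And>z. z \<in> M \<Longrightarrow> \<psi> z = hp_point (s z)" and M: "M \<noteq> {}"
    and iso: "isotropic_up_to M \<psi> n"
  shows "1 \<le> m \<Longrightarrow> m \<le> n \<Longrightarrow> isotropic m"
proof (induction m)
  case 0
  then show ?case by simp
next
  case (Suc m)
  show ?case
  proof (cases "m = 0")
    case True
    then show ?thesis using isotropic_1 by simp
  next
    case False
    then have m: "isotropic m" "1 \<le> m" using Suc by auto
    obtain U where U: "U \<subseteq> M" "U \<noteq> {}" "regular U (Suc m)"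
      using exists_regular[OF open_M M, of "Suc m"] by blast
    have zero: "A e (Suc m) w = 0 \<and> C e (Suc m) w = 0" if w: "w \<in> U" and e: "\<bar>e\<bar> = 1" for w e
    proof -
      have "\<psi> w = cspan2 (s w) (jmul (s w))"
        using \<psi>[of w] w U(1) by (auto simp: hp_point_eq_cspan2)
      moreover have "harmonic_sequence \<psi> (Suc m) w = cspan2 (v 1 (Suc m) w) (jmul (v (-1) (Suc m) w))"
        using hp_sequence[OF U(3) m _ \<psi>, of "Suc m" w] w by simp
      moreover have "\<forall>x\<in>\<psi> w. \<forall>y\<in>harmonic_sequence \<psi> (Suc m) w. herm x y = 0"
        using iso Suc.prems w U(1) unfolding isotropic_up_to_def perp_bundles_def by force
      \<comment> \<open>Up to sign and conjugation, these four products are A and C of order m + 1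
        for both signs.\<close>
      ultimately have h: "herm (s w) (v 1 (Suc m) w) = 0" "herm (jmul (s w)) (v 1 (Suc m) w) = 0"
        "herm (s w) (jmul (v (-1) (Suc m) w)) = 0" "herm (jmul (s w)) (jmul (v (-1) (Suc m) w)) = 0"
        by (simp_all add: mem_cspan2)
      have "herm (v e (Suc m) w) (s w) = 0 \<and> herm (v e (Suc m) w) (jmul (s w)) = 0"
      proof (cases "e = 1")
        case True
        then show ?thesis using h(1,2) herm_eq_0_sym by blast
      next
        case False
        then have "e = -1" using e by linarith
        moreover have "herm (v (-1) (Suc m) w) (jmul (s w)) = 0"
          using h(3) herm_jmul_right[of "s w" "v (-1) (Suc m) w"] by simp
        moreover have "herm (v (-1) (Suc m) w) (s w) = 0"
          using h(4) herm_eq_0_sym[of "s w"] by (simp add: herm_jmul_jmul)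
        ultimately show ?thesis by simp
      qed
      then show ?thesis using herm_v_Suc_s[OF U(3) e m(1) _ w] by simp
    qed
    have "open U" using U(3) by (simp add: regular_def)
    have "A e (Suc m) z = 0 \<and> C e (Suc m) z = 0" if "z \<in> M" "\<bar>e\<bar> = 1" for z e
      using A_C_identity[OF that(2) m \<open>open U\<close> U(2,1) that(1)] zero that(2) by blast
    then show ?thesis using m(1) by (auto simp: isotropic_def le_Suc_eq)
  qed
qed

section \<open>Perpendicularity on all of M and the isotropy orders of [s]\<close>

lemma norm_s: "z \<in> M \<Longrightarrow> norm (s z) = 1"
  using unit_s[of z] norm_ge_zero[of "s z"] by (simp add: herm_self power2_eq_1_iff flip: of_real_power)

lemma continuous_s: "continuous_on M s"
  by (rule smooth_on_imp_continuous_on[OF smooth_s])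

lemma continuous_js: "continuous_on M (\<lambda>z. jmul (s z))"
  by (intro smooth_on_imp_continuous_on smooth_intros open_M smooth_s)

text \<open>A converse of \<open>isotropic_if_isotropic_up_to\<close>, one index further. Frames
  exist only over regular sets; \<open>next_bundle_perp\<close> covers the limit fibres
  elsewhere.\<close>

lemma perp_if_isotropic_Suc:
  assumes \<psi>: "\<And>z. z \<in> M \<Longrightarrow> \<psi> z = hp_point (s z)" 
    and n: "isotropic (Suc n)" "1 \<le> n"
  shows "perp_bundles M (harmonic_sequence \<psi> 0) (harmonic_sequence \<psi> (Suc n))"
proof -
  have n': "isotropic n" using n(1) by (auto simp: isotropic_def)
  have dense: "\<exists>w\<in>V. A'_image (harmonic_sequence \<psi> n) w \<noteq> {} \<and>
      (\<forall>y\<in>A'_image (harmonic_sequence \<psi> n) w. herm (s w) y = 0 \<and> herm (jmul (s w)) y = 0)"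
    if V: "open V" "V \<noteq> {}" "V \<subseteq> M" for V
  proof -
    obtain U w where U: "U \<subseteq> V" "w \<in> U" "regular U (Suc n)"
      using exists_regular[OF V, of "Suc n"] by blast
    have im: "A'_image (harmonic_sequence \<psi> n) w = cspan2 (v 1 (Suc n) w) (jmul (v (-1) (Suc n) w))"
      using A'_image_hp_sequence[OF U(3) n' n(2) _ \<psi> U(2)] by simp
    have h: "herm (v e (Suc n) w) (s w) = 0" "herm (v e (Suc n) w) (jmul (s w)) = 0" if "\<bar>e\<bar> = 1" for e
      by (rule v_perp[OF U(3) that n(1) _ _ _ U(2)]; simp)+
    have "herm (s w) y = 0 \<and> herm (jmul (s w)) y = 0" if "y \<in> A'_image (harmonic_sequence \<psi> n) w" for y
    proof -
      have "herm (s w) (v 1 (Suc n) w) = 0" "herm (jmul (s w)) (v 1 (Suc n) w) = 0"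
        "herm (s w) (jmul (v (-1) (Suc n) w)) = 0" "herm (jmul (s w)) (jmul (v (-1) (Suc n) w)) = 0"
        using herm_eq_0_sym[OF h(1)[of 1]] herm_eq_0_sym[OF h(2)[of 1]] h(2)[of "-1"]
          herm_eq_0_sym[OF h(1)[of "-1"]]
        by (simp_all add: herm_jmul_jmul herm_jmul_right[of "s w" "v (-1) (Suc n) w"])
      then show ?thesis using that herm_cspan2_right unfolding im by blast
    qed
    moreover have "A'_image (harmonic_sequence \<psi> n) w \<noteq> {}" unfolding im using mem_cspan2 by blast
    ultimately show ?thesis using U by blast
  qed
  have "herm u x = 0" if z: "z \<in> M" and u: "u \<in> \<psi> z" and x: "x \<in> next_bundle (harmonic_sequence \<psi> n) z" for z u x
  proof -
    have sx: "herm (s z) x = 0"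
    proof (rule next_bundle_perp[OF open_M z continuous_s norm_s _ x])
      fix V assume "open V" "V \<noteq> {}" "V \<subseteq> M"
      from dense[OF this] show "\<exists>w\<in>V. A'_image (harmonic_sequence \<psi> n) w \<noteq> {} \<and>
        (\<forall>y\<in>A'_image (harmonic_sequence \<psi> n) w. herm (s w) y = 0)" by blast
    qed
    have jx: "herm (jmul (s z)) x = 0"
    proof (rule next_bundle_perp[OF open_M z continuous_js _ _ x])
      fix V assume "open V" "V \<noteq> {}" "V \<subseteq> M"
      from dense[OF this] show "\<exists>w\<in>V. A'_image (harmonic_sequence \<psi> n) w \<noteq> {} \<and>
        (\<forall>y\<in>A'_image (harmonic_sequence \<psi> n) w. herm (jmul (s w)) y = 0)" by blast
    qed (simp add: norm_jmul norm_s)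
    have "herm x u = 0"
      using u \<psi>[OF z] herm_cspan2_right[OF herm_eq_0_sym[OF sx] herm_eq_0_sym[OF jx]]
      by (simp add: hp_point_eq_cspan2)
    then show ?thesis by (rule herm_eq_0_sym)
  qed
  then show ?thesis by (simp add: perp_bundles_def)
qed

lemma cp_perp_if_dense:
  assumes dense: "\<And>V. open V \<Longrightarrow> V \<noteq> {} \<Longrightarrow> V \<subseteq> M \<Longrightarrow>
      \<exists>w\<in>V. \<exists>a. A'_image (harmonic_sequence (\<lambda>z. cp_point (s z)) i) w = cspan2 a 0 \<and> herm (s w) a = 0"
  shows "perp_bundles M (harmonic_sequence (\<lambda>z. cp_point (s z)) 0) (harmonic_sequence (\<lambda>z. cp_point (s z)) (Suc i))"
proof -
  have "herm (s z) x = 0" if z: "z \<in> M" and x: "x \<in> next_bundle (harmonic_sequence (\<lambda>z. cp_point (s z)) i) z" for z x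
  proof (rule next_bundle_perp[OF open_M z continuous_s norm_s _ x])
    fix V assume "open V" "V \<noteq> {}" "V \<subseteq> M"
    from dense[OF this] obtain w a where "w \<in> V"
      "A'_image (harmonic_sequence (\<lambda>z. cp_point (s z)) i) w = cspan2 a 0" "herm (s w) a = 0" by blast
    then show "\<exists>w\<in>V. A'_image (harmonic_sequence (\<lambda>z. cp_point (s z)) i) w \<noteq> {} \<and>
        (\<forall>y\<in>A'_image (harmonic_sequence (\<lambda>z. cp_point (s z)) i) w. herm (s w) y = 0)"
      using mem_cspan2(1)[of a 0] herm_cspan2_right[of "s w" a 0] by (intro bexI[of _ w]) auto
  qed
  then show ?thesis by (auto simp: perp_bundles_def cp_point_def herm_scale_left)
qed

lemma isotropy_orderI:
  assumes "\<And>i. i < r \<Longrightarrow> perp_bundles M (harmonic_sequence \<psi> 0) (harmonic_sequence \<psi> (Suc i))"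
    "\<not> perp_bundles M (harmonic_sequence \<psi> 0) (harmonic_sequence \<psi> (Suc r))"
  shows "isotropy_order M \<psi> r"
  unfolding isotropy_order_def
proof (intro conjI allI impI)
  show "isotropic_up_to M \<psi> r" unfolding isotropic_up_to_def
  proof
    fix i assume "i \<in> {1..r}"
    then show "perp_bundles M (harmonic_sequence \<psi> 0) (harmonic_sequence \<psi> i)"
      using assms(1)[of "i - 1"] by (cases i) auto
  qed
  fix r' assume r': "isotropic_up_to M \<psi> r'"
  show "r' \<le> r"
  proof (rule ccontr)
    assume "\<not> r' \<le> r"
    then have "Suc r \<in> {1..r'}" by simp
    then show False using r' assms(2) unfolding isotropic_up_to_def by blast
  qed
qed

text \<open>Perpendicularity fails at index n + 1 at a regular point where A is nonzero, since the
  fibre there contains \<open>v 1 (Suc n)\<close>.\<close>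

lemma isotropy_order_cp_n:
  assumes n: "isotropic n" "1 \<le> n" and z0: "z0 \<in> M" "A 1 (Suc n) z0 \<noteq> 0"
  shows "isotropy_order M (\<lambda>z. cp_point (s z)) n"
proof (rule isotropy_orderI)
  fix i assume i: "i < n"
  show "perp_bundles M (harmonic_sequence (\<lambda>z. cp_point (s z)) 0) (harmonic_sequence (\<lambda>z. cp_point (s z)) (Suc i))"
  proof (rule cp_perp_if_dense)
    fix V assume V: "open V" "V \<noteq> {}" "V \<subseteq> M"
    obtain U w where U: "U \<subseteq> V" "w \<in> U" "regular U n"
      using exists_regular[OF V, of n] by blast
    have "herm (s w) (v 1 (Suc i) w) = 0"
      by (rule herm_eq_0_sym, rule v_perp(1)[OF U(3) _ n(1) _ _ _ U(2)]) (use i in auto)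
    then show "\<exists>w\<in>V. \<exists>a. A'_image (harmonic_sequence (\<lambda>z. cp_point (s z)) i) w = cspan2 a 0 \<and> herm (s w) a = 0"
      using A'_image_cp_sequence[OF U(3) _ U(2), of i] i U by (intro bexI[of _ w]) auto
  qed
next
  have "open (M \<inter> A 1 (Suc n) -` (- {0}))"
    by (rule continuous_open_preimage[OF smooth_on_imp_continuous_on[OF smooth_A] open_M]) (simp add: open_Compl)
  then obtain U w where U: "U \<subseteq> M \<inter> A 1 (Suc n) -` (- {0})" "w \<in> U" "regular U (Suc n)"
    using exists_regular[of "M \<inter> A 1 (Suc n) -` (- {0})" "Suc n"] z0 by blast
  have "herm (v 1 (Suc n) w) (s w) = A 1 (Suc n) w"
    by (rule herm_v_Suc_s(1)[OF U(3) _ n(1) _ U(2)]) auto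
  then have "herm (s w) (v 1 (Suc n) w) \<noteq> 0" using U(1,2) herm_eq_0_sym[of "s w" "v 1 (Suc n) w"] by auto
  moreover have "s w \<in> harmonic_sequence (\<lambda>z. cp_point (s z)) 0 w"
    using mem_cspan2 by (simp add: cp_point_eq_cspan2)
  moreover have "v 1 (Suc n) w \<in> harmonic_sequence (\<lambda>z. cp_point (s z)) (Suc n) w"
    unfolding cp_sequence[OF U(3) order_refl U(2)] by (rule mem_cspan2)
  ultimately show "\<not> perp_bundles M (harmonic_sequence (\<lambda>z. cp_point (s z)) 0) (harmonic_sequence (\<lambda>z. cp_point (s z)) (Suc n))"
    using U unfolding perp_bundles_def by blast
qed

text \<open>The vectors \<open>v e i\<close> and \<open>jmul (v (- e) i)\<close> with i \<le> n form
  an orthogonal basis. As A vanishes, \<open>v e (Suc n)\<close> is perpendicular to all of them but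
  the unit vector j s.\<close>

lemma v_Suc_eq_C_jmul:
  assumes card: "CARD('m) = Suc n" and n: "isotropic n" "1 \<le> n" and e: "\<bar>e\<bar> = 1"
    and A0: "\<And>z. z \<in> M \<Longrightarrow> A e (Suc n) z = 0"
    and U: "regular U (Suc n)" and w: "w \<in> U"
    and nz: "\<And>i. i \<le> n \<Longrightarrow> v e i w \<noteq> 0" "\<And>i. i \<le> n \<Longrightarrow> v (- e) i w \<noteq> 0"
  shows "v e (Suc n) w = C e (Suc n) w *s jmul (s w)"
proof -
  have e': "\<bar>- e\<bar> = 1" using e by simp
  have wM: "w \<in> M" using U w by (auto simp: regular_def)
  have nk: "n \<le> Suc n" by simp
  \<comment> \<open>Indices n + 1 to 2n + 1 hold \<open>jmul (v (- e) 0)\<close> to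
    \<open>jmul (v (- e) n)\<close>.\<close>
  define b where "b = (\<lambda>i. if i \<le> n then v e i w else jmul (v (- e) (i - Suc n) w))"
  define x where "x = v e (Suc n) w - C e (Suc n) w *s jmul (s w)"
  have vs: "herm (v e (Suc n) w) (s w) = 0" "herm (v e (Suc n) w) (jmul (s w)) = C e (Suc n) w"
    using herm_v_Suc_s[OF U e n(1) nk w] A0[OF wM] by auto
  have js: "herm (jmul (s w)) (v e i w) = 0" if "i \<le> n" for i
    using herm_eq_0_sym[OF v_perp(2)[OF U e n(1) le_SucI[OF nk] _ that w]] herm_eq_0_sym[OF herm_jmul_self, of "s w"]
    by (cases "i = 0") auto
  have jj: "herm (jmul (s w)) (jmul (v (- e) i w)) = (if i = 0 then 1 else 0)" if "i \<le> n" for i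
    using herm_eq_0_sym[OF v_perp(1)[OF U e' n(1) le_SucI[OF nk] _ that w]] unit_s[OF wM]
    by (cases "i = 0") (auto simp: herm_jmul_jmul)
  have xv: "herm x (v e i w) = 0" if "i \<le> n" for i
    using vs js[OF that] v_Suc_perp_v[OF U e n(1) nk _ that w]
    by (cases "i = 0") (auto simp: x_def herm_diff_left herm_scale_left)
  have xj: "herm x (jmul (v (- e) i w)) = 0" if "i \<le> n" for i
    using vs jj[OF that] v_Suc_perp_jmul_v[OF U e n(1) nk _ that w]
    by (cases "i = 0") (auto simp: x_def herm_diff_left herm_scale_left)
  have "x = 0"
  proof (rule eq_0_if_perp_orthogonal_basis[of b])
    fix i j assume ij: "i < 2 * CARD('m)" "j < i"
    consider "i \<le> n" | "n < i" "j \<le> n" | "n < j" by force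
    then show "herm (b i) (b j) = 0"
    proof cases
      case 1
      then show ?thesis using v_perp_v[OF U e n(1) nk ij(2) 1 w] ij by (simp add: b_def)
    next
      case 2
      then have "herm (v e j w) (jmul (v (- e) (i - Suc n) w)) = 0"
        using ij w card by (intro v_perp_jmul_v[OF U e n(1) nk]) auto
      from herm_eq_0_sym[OF this] show ?thesis using 2 by (simp add: b_def)
    next
      case 3
      then show ?thesis using v_perp_v[OF U e' n(1) nk, of "j - Suc n" "i - Suc n" w] ij w card
        by (simp add: b_def herm_jmul_jmul)
    qed
  next
    fix i assume i: "i < 2 * CARD('m)"
    show "b i \<noteq> 0" using nz(1)[of i] nz(2)[of "i - Suc n"] i card by (auto simp: b_def)
    show "herm x (b i) = 0" using xv[of i] xj[of "i - Suc n"] i card by (auto simp: b_def)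
  qed
  then show ?thesis by (simp add: x_def)
qed

lemma isotropy_order_cp_2n_1:
  assumes card: "CARD('m) = Suc n" and n: "isotropic n" "1 \<le> n"
    and A0: "\<And>z. z \<in> M \<Longrightarrow> A 1 (Suc n) z = 0"
    and z0: "\<bar>e0\<bar> = 1" "z0 \<in> M" "C e0 (Suc n) z0 \<noteq> 0"
  shows "isotropy_order M (\<lambda>z. cp_point (s z)) (2 * n + 1)"
proof -
  let ?g = "\<lambda>z. cp_point (s z)"
  have A0': "A e (Suc n) z = 0" if "\<bar>e\<bar> = 1" "z \<in> M" for e z
  proof -
    have "A (-1) (Suc n) z = 0"
      using that(2) n(1) A0 by (intro A_reverse) (auto simp: isotropic_def le_Suc_eq)
    moreover have "e = 1 \<or> e = -1" using that(1) by linarith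
    ultimately show ?thesis using A0[OF that(2)] by auto
  qed
  \<comment> \<open>C is known to be nonzero for the sign e0 only; equality of norms carries this
    over to the other sign.\<close>
  have good: "\<exists>U\<subseteq>V. U \<noteq> {} \<and> regular U (Suc n) \<and>
      (\<forall>w\<in>U. \<forall>e. \<bar>e\<bar> = 1 \<longrightarrow> C e (Suc n) w \<noteq> 0 \<and> v e (Suc n) w = C e (Suc n) w *s jmul (s w))"
    if V: "open V" "V \<noteq> {}" "V \<subseteq> M" for V
  proof -
    have "open (V \<inter> C e0 (Suc n) -` (- {0}))"
      by (rule continuous_open_preimage[OF continuous_on_subset[OF smooth_on_imp_continuous_on[OF smooth_C] V(3)] V(1)])
        (simp add: open_Compl)
    \<comment> \<open>If C vanished on all of V, it would vanish at z0 by the identity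
      theorem.\<close>
    moreover have "V \<inter> C e0 (Suc n) -` (- {0}) \<noteq> {}"
      using A_C_identity(2)[OF z0(1) n V z0(2)] z0(3) by blast
    ultimately obtain U where U: "U \<subseteq> V \<inter> C e0 (Suc n) -` (- {0})" "U \<noteq> {}" "regular U (Suc n)"
      using exists_regular[of "V \<inter> C e0 (Suc n) -` (- {0})" "Suc n"] V by blast
    have "C e (Suc n) w \<noteq> 0 \<and> v e (Suc n) w = C e (Suc n) w *s jmul (s w)" if w: "w \<in> U" and e: "\<bar>e\<bar> = 1" for w e
    proof -
      have "herm (v e0 (Suc n) w) (jmul (s w)) \<noteq> 0"
        using herm_v_Suc_s(2)[OF U(3) z0(1) n(1) _ w] U(1) w by auto
      then have "v e0 (Suc n) w \<noteq> 0" by auto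
      then have nz: "v e0 i w \<noteq> 0" if "i \<le> Suc n" for i
        using v_nonvanishing_mono[OF U(3) z0(1) w _ _ that w that] by simp
      have nz': "v (- e0) i w \<noteq> 0" if "i \<le> Suc n" for i
        using N_symmetric[OF U(3) z0(1) _ w, of i] nz[OF that] that by (auto simp: N_def)
      have "e = e0 \<or> e = - e0" using e z0(1) by linarith
      then have nz_e: "v e i w \<noteq> 0" "v (- e) i w \<noteq> 0" if "i \<le> Suc n" for i
        using nz[OF that] nz'[OF that] by auto
      have "v e (Suc n) w = C e (Suc n) w *s jmul (s w)"
        by (rule v_Suc_eq_C_jmul[OF card n e A0'[OF e] U(3) w]) (use nz_e in auto)
      then show ?thesis using nz_e(1)[of "Suc n"] by auto
    qed
    then show ?thesis using U by blast
  qed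
  have seq: "harmonic_sequence ?g (Suc n) x = cspan2 (jmul (s x)) 0"
    if "regular U (Suc n)" "\<forall>w\<in>U. \<forall>e. \<bar>e\<bar> = 1 \<longrightarrow> C e (Suc n) w \<noteq> 0 \<and> v e (Suc n) w = C e (Suc n) w *s jmul (s w)"
      "x \<in> U" for U x
    using cp_sequence[OF that(1) order_refl that(3)] that(2,3) cspan2_scale_0[of "C 1 (Suc n) x"] by simp
  show ?thesis
  proof (rule isotropy_orderI)
    fix i assume i: "i < 2 * n + 1"
    show "perp_bundles M (harmonic_sequence ?g 0) (harmonic_sequence ?g (Suc i))"
    proof (rule cp_perp_if_dense)
      fix V assume V: "open V" "V \<noteq> {}" "V \<subseteq> M"
      obtain U w where U: "U \<subseteq> V" "regular U (Suc n)" "w \<in> U"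
        and C: "\<forall>w\<in>U. \<forall>e. \<bar>e\<bar> = 1 \<longrightarrow> C e (Suc n) w \<noteq> 0 \<and> v e (Suc n) w = C e (Suc n) w *s jmul (s w)"
        using good[OF V] by blast
      have wM: "w \<in> M" using U V by blast
      show "\<exists>w\<in>V. \<exists>a. A'_image (harmonic_sequence ?g i) w = cspan2 a 0 \<and> herm (s w) a = 0"
      proof (cases "i \<le> n")
        case True
        have "herm (v 1 (Suc i) w) (s w) = 0"
        proof (cases "i = n")
          case True
          then show ?thesis using herm_v_Suc_s(1)[OF U(2) _ n(1) _ U(3), of 1] A0[OF wM] by simp
        next
          case False
          then show ?thesis using v_perp(1)[OF U(2) _ n(1) _ _ _ U(3), of 1 "Suc i"] \<open>i \<le> n\<close> by simp
        qed
        then show ?thesis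
          using A'_image_cp_sequence[OF U(2) _ U(3), of i] True U(1,3) herm_eq_0_sym
          by (intro bexI[of _ w] exI[of _ "v 1 (Suc i) w"]) auto
      next
        case False
        \<comment> \<open>Past index n the steps are counted from [j s], which sits at index n +
          1.\<close>
        define l where "l = i - Suc n"
        have l: "i = Suc n + l" "Suc l \<le> n" using False i by (auto simp: l_def)
        have "herm (s w) (jmul (v (-1) (Suc l) w)) = 0"
          using v_perp(2)[OF U(2) _ n(1) _ _ l(2) U(3), of "-1"] by (simp add: herm_jmul_right[of "s w"])
        moreover have "A'_image (harmonic_sequence ?g i) w = cspan2 (jmul (v (-1) (Suc l) w)) 0"
          unfolding l(1) using A'_image_cp_sequence_jmul[OF U(2) seq[OF U(2) C] _ U(3), of l] l by simp
        ultimately show ?thesis using U by blast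
      qed
    qed
  next
    have "M \<noteq> {}" using z0 by blast
    then obtain U w where U: "U \<subseteq> M" "regular U (Suc n)" "w \<in> U"
      and C: "\<forall>w\<in>U. \<forall>e. \<bar>e\<bar> = 1 \<longrightarrow> C e (Suc n) w \<noteq> 0 \<and> v e (Suc n) w = C e (Suc n) w *s jmul (s w)"
      using good[OF open_M] by blast
    have *: "Suc (2 * n + 1) = Suc n + Suc n" by simp
    have "harmonic_sequence ?g (Suc (2 * n + 1)) w = cspan2 (jmul (v (-1) (Suc n) w)) 0"
      unfolding * by (rule cp_sequence_jmul[OF U(2) seq[OF U(2) C] order_refl U(3)])
    then have "jmul (v (-1) (Suc n) w) \<in> harmonic_sequence ?g (Suc (2 * n + 1)) w"
      using mem_cspan2 by blast
    \<comment> \<open>This section is j applied to a nonzero multiple of j s, hence a nonzero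
      multiple of s.\<close>
    moreover have "herm (s w) (jmul (v (-1) (Suc n) w)) \<noteq> 0"
      using C U(3) unit_s[of w] U(1)
      by (auto simp: jmul_scale jmul_jmul herm_scale_right herm_minus_right subset_iff)
    moreover have "s w \<in> harmonic_sequence ?g 0 w"
      using mem_cspan2 by (simp add: cp_point_eq_cspan2)
    ultimately show "\<not> perp_bundles M (harmonic_sequence ?g 0) (harmonic_sequence ?g (Suc (2 * n + 1)))"
      using U unfolding perp_bundles_def by blast
  qed
qed

end

section \<open>From harmonicity of the map to the equation of its lift\<close>

lemma horizontal_wd:
  assumes "\<And>X. horizontal (s z) (dd s z X)"
  shows "herm (wd e s z) (s z) = 0" "herm (wd e s z) (jmul (s z)) = 0"
  using assms by (simp_all add: horizontal_def wd_def herm_scale_left herm_diff_left)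

text \<open>Differentiating horizontality leaves an extra term \<open>herm u (jmul u)\<close>, which
  is zero because the form is alternating.\<close>

lemma horizontal_lift_second_derivative:
  fixes s :: "complex \<Rightarrow> 'm::finite hvec"
  assumes M: "open M" and z: "z \<in> M" and s: "smooth_on M s"
    and hor: "\<And>z X. z \<in> M \<Longrightarrow> horizontal (s z) (dd s z X)" and b: "b \<in> Basis"
  shows "herm (dd (\<lambda>w. dd s w b) z b) (jmul (s z)) = 0"
proof -
  have 1: "herm (dd s z b) (jmul (dd s z b)) + herm (dd (\<lambda>w. dd s w b) z b) (jmul (s z)) = 0"
  proof -
    have "dd (\<lambda>w. herm (dd s w b) (jmul (s w))) z b
        = herm (dd s z b) (dd (\<lambda>w. jmul (s w)) z b) + herm (dd (\<lambda>w. dd s w b) z b) (jmul (s z))"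
      by (rule dd_bilinear_on[OF z bounded_bilinear_herm smooth_on_dd[OF s b]
            smooth_on_linear[OF bounded_linear_jmul M s]])
    moreover have "dd (\<lambda>w. herm (dd s w b) (jmul (s w))) z = dd (\<lambda>_. 0) z"
      by (rule dd_cong_open[OF M z]) (use hor in \<open>auto simp: horizontal_def\<close>)
    ultimately show ?thesis by (simp add: dd_linear_on[OF z bounded_linear_jmul s])
  qed
  then show ?thesis by simp
qed

text \<open>For a horizontal lift the correction in \<open>hp_cov\<close> vanishes, so harmonicity
  removes the horizontal part of the Laplacian of s. Its component along j s is zero too, which
  leaves a multiple of s.\<close>

lemma horizontal_harmonic_wd_wd:
  assumes e: "\<bar>e\<bar> = 1" and z: "z \<in> M" and lift: "hp_lift M \<phi> s"
    and hor: "\<And>z X. z \<in> M \<Longrightarrow> horizontal (s z) (dd s z X)"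
    and lam: "0 < lam z" and harm: "hp_tension lam s z = 0"
  shows "wd (- e) (wd e s) z = - ((- (herm (dd (\<lambda>w. dd s w 1) z 1 + dd (\<lambda>w. dd s w \<i>) z \<i>) (s z) / 4)) *s s z)"
proof -
  have M: "open M" and s: "smooth_on M s" using lift by (auto simp: hp_lift_def)
  have diff: "hp_diff s w X = dd s w X" if "w \<in> M" for w X
    using hor[OF that, of X] by (simp add: hp_diff_def hp_hor_def horizontal_def)
  define L where "L = dd (\<lambda>w. dd s w 1) z 1 + dd (\<lambda>w. dd s w \<i>) z \<i>"
  have cov: "hp_cov s (\<lambda>w. hp_diff s w b) z b = hp_hor (s z) (dd (\<lambda>w. dd s w b) z b)" for b
    using hor[OF z, of b] dd_cong_open[OF M z, of "\<lambda>w. hp_diff s w b" "\<lambda>w. dd s w b"] diff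
    by (simp add: hp_cov_def horizontal_def)
  have "hp_hor (s z) (dd (\<lambda>w. dd s w 1) z 1) + hp_hor (s z) (dd (\<lambda>w. dd s w \<i>) z \<i>) = 0"
    using harm lam by (simp add: hp_tension_def cov)
  then have "hp_hor (s z) L = 0"
    unfolding L_def by (simp add: hp_hor_def herm_add_left vec_eq_iff algebra_simps)
  moreover have "herm L (jmul (s z)) = 0"
    unfolding L_def herm_add_left
    by (simp add: horizontal_lift_second_derivative[OF M z s hor])
  ultimately have L: "L = herm L (s z) *s s z" by (simp add: hp_hor_def)
  have ee: "e * e = 1" using e by (metis abs_mult_self_eq mult_1)
  have "wd (- e) (wd e s) z = (1/4) *s L"
    unfolding wd_wd[OF M z s] L_def using ee by (simp add: vec_eq_iff)
  then show ?thesis using L unfolding L_def[symmetric] by (simp add: vec_eq_iff)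
qed

theorem proposition3p6:
  fixes M :: "complex set"
    and lam :: "complex \<Rightarrow> real"
    and \<phi> :: "complex \<Rightarrow> (complex ^ ('m::finite \<times> 2)) set"
    and s :: "complex \<Rightarrow> complex ^ ('m \<times> 2)"
    and n :: nat
  assumes "CARD('m) = n + 1"
    and "open M" and "M \<noteq> {}" and "simply_connected M"
    and "smooth_on M lam" and "\<forall>z\<in>M. 0 < lam z"
    and "hp_smooth M \<phi>"
    and "hp_linearly_full M \<phi>"
    and "hp_totally_real M \<phi>"
    and "hp_isometric M lam \<phi>"
    and "hp_harmonic M lam \<phi>"
    and "isotropy_order M \<phi> n"
    and "totally_real_horizontal_minimal_lift M lam \<phi> s"
  shows "isotropy_order M (\<lambda>z. cp_point (s z)) n \<or>
         isotropy_order M (\<lambda>z. cp_point (s z)) (2 * n + 1)"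
proof -
  have lift: "hp_lift M \<phi> s" and hor: "\<And>z X. z \<in> M \<Longrightarrow> horizontal (s z) (dd s z X)"
    using assms(13) by (auto simp: totally_real_horizontal_minimal_lift_def)
  then have s: "smooth_on M s" and norm_s: "\<And>z. z \<in> M \<Longrightarrow> norm (s z) = 1"
    and \<phi>: "\<And>z. z \<in> M \<Longrightarrow> \<phi> z = hp_point (s z)"
    by (auto simp: hp_lift_def)
  define \<rho> where "\<rho> = (\<lambda>z. - (herm (dd (\<lambda>w. dd s w 1) z 1 + dd (\<lambda>w. dd s w \<i>) z \<i>) (s z) / 4))"
  interpret horizontal_harmonic_lift M s \<rho>
  proof
    show "connected M" using assms(4) by (rule simply_connected_imp_connected)
    fix e :: real and z assume e: "\<bar>e\<bar> = 1" and z: "z \<in> M"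
    have "hp_tension lam s z = 0" using assms(11) lift z by (auto simp: hp_harmonic_def)
    then show "wd (- e) (wd e s) z = - (\<rho> z *s s z)"
      unfolding \<rho>_def using e z lift hor assms(6) by (intro horizontal_harmonic_wd_wd) auto
  qed (use assms(2) s norm_s horizontal_wd[OF hor] in \<open>auto simp: herm_self\<close>)
  \<comment> \<open>For n = 0 the vectors s and j s span the whole space, so the horizontal
    derivative of s is zero, contrary to isometry with positive \<open>lam\<close>.\<close>
  have n: "1 \<le> n"
  proof (rule ccontr)
    assume "\<not> 1 \<le> n"
    then have c: "CARD('m) = 1" using assms(1) by simp
    obtain z where z: "z \<in> M" using assms(3) by blast
    define b where "b = (\<lambda>i::nat. if i = 0 then s z else jmul (s z))"
    have "dd s z 1 = 0"
    proof (rule eq_0_if_perp_orthogonal_basis[of b])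
      fix i j :: nat assume "i < 2 * CARD('m)" "j < i"
      then have "i = 1" "j = 0" using c by auto
      then show "herm (b i) (b j) = 0" using herm_eq_0_sym[OF herm_jmul_self[of "s z"]] by (simp add: b_def)
    next
      fix i
      show "b i \<noteq> 0" using norm_s[OF z] by (auto simp: b_def)
      show "herm (dd s z 1) (b i) = 0" using hor[OF z, of 1] by (auto simp: b_def horizontal_def)
    qed
    moreover have "hp_diff s z 1 \<bullet> hp_diff s z 1 = lam z * ((1::complex) \<bullet> 1)"
      using assms(10) lift z unfolding hp_isometric_def by blast
    ultimately show False using assms(6) z by (auto simp: hp_diff_def hp_hor_def)
  qed
  have up_to: "isotropic_up_to M \<phi> n" and max: "\<not> isotropic_up_to M \<phi> (Suc n)"
    using assms(12) by (auto simp: isotropy_order_def)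
  have iso: "isotropic n"
    by (rule isotropic_if_isotropic_up_to[OF \<phi> assms(3) up_to n order_refl])
  \<comment> \<open>Otherwise the bundle at index n + 1 would be perpendicular as well, against the
    maximality of n.\<close>
  have "\<not> isotropic (Suc n)"
  proof
    assume "isotropic (Suc n)"
    from perp_if_isotropic_Suc[OF \<phi> this n] up_to have "isotropic_up_to M \<phi> (Suc n)"
      unfolding isotropic_up_to_def by (auto simp: le_Suc_eq)
    then show False using max by blast
  qed
  then obtain e z where e: "\<bar>e\<bar> = 1" "z \<in> M" "A e (Suc n) z \<noteq> 0 \<or> C e (Suc n) z \<noteq> 0"
    using iso unfolding isotropic_def by (metis le_Suc_eq)
  show ?thesis
  proof (cases "\<exists>z\<in>M. A 1 (Suc n) z \<noteq> 0")
    case True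
    then show ?thesis using isotropy_order_cp_n[OF iso n] by blast
  next
    case False
    then have A0: "A 1 (Suc n) z = 0" if "z \<in> M" for z using that by blast
    \<comment> \<open>Vanishing of A passes to the other sign, so the nonzero value found above
      belongs to C.\<close>
    have "A f (Suc n) z = 0" if "\<bar>f\<bar> = 1" "z \<in> M" for f z
    proof -
      have "A (-1) (Suc n) z = 0"
        using that(2) iso A0 by (intro A_reverse) (auto simp: isotropic_def le_Suc_eq)
      moreover have "f = 1 \<or> f = -1" using that(1) by linarith
      ultimately show ?thesis using A0[OF that(2)] by auto
    qed
    then have "C e (Suc n) z \<noteq> 0" using e by blast
    then show ?thesis
      using isotropy_order_cp_2n_1[OF _ iso n A0 e(1,2)] assms(1) by simp
  qed
qed

end
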